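(* Let $\mathcal X\subseteq\mathbb R^{d_x}$, $\mathcal Y\subseteq\mathbb R^{d_y}$, $\mathcal Z\subseteq\mathbb R^{d_z}$ be nonempty Polish subspaces (with the relative Euclidean topology), $\mathcal Z$ closed, and let $(X,Y)$ be a random vector with values in $\mathcal X\times\mathcal Y$ and conditional distributions $P_{Y|X=x}$, $x\in\mathcal X$. Fix $p\ge 1$. Assume: (a) $\rho^{(2)}:L^p\to\mathbb R$ is a law-invariant convex risk measure; (b) $g:\mathcal X\to\mathcal Z$ is a continuous function (policy); (c) the cost function $c(z,y)$ is continuous in $(z,y)$, and there exist $\iota\ge 0$ and a locally bounded non-negative function $\eta:\mathcal Z\to\mathbb R$ such that $|c(z,y)|\le \eta(z)(\|y\|^\iota+1)$ for all $(z,y)\in\mathcal Z\times\mathcal Y$; (d) the map $x\mapsto P_{Y|X=x}$ is continuous on $\mathcal X$ with respect to the $\|\cdot\|^{\iota p}$-weak topology. Then the function $x\mapsto \rho^{(2)}_{P_{Y|X=x}}\big(c(g(x),Y)\big)$, from $\mathcal X$ to $\mathbb R$, is continuous on $\mathcal X$.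
   Context: Risk measures. $L^p$ is the space of real random variables with finite $p$-th moment on a nonatomic probability space. A map $\rho:L^p\to\mathbb R$ is a convex risk measure if it is monotone ($\xi\ge\zeta$ a.s. implies $\rho(\xi)\ge\rho(\zeta)$), cash invariant ($\rho(\xi+a)=\rho(\xi)+a$ for $a\in\mathbb R$), and convex. It is law invariant if $\rho(\xi)=\rho(\zeta)$ whenever $\xi,\zeta$ have the same distribution; then it induces a functional $\varrho$ on the set $\mathcal M_1^p$ of probability measures on $\mathbb R$ with finite $p$-th moment, $\varrho(\mu)=\rho(F_\mu^{-1}(U))$, where $U$ is uniform on $[0,1]$ and $F_\mu^{-1}$ is the quantile function of $\mu$. For a probability measure $Q$ (the law of a random element $W$) and a measurable real function $\phi$ with $Q\circ\phi^{-1}\in\mathcal M_1^p$, write $\rho_Q(\phi(W)):=\varrho(Q\circ\phi^{-1})$. In particular $\rho^{(2)}_{P_{Y|X=x}}(c(z,Y))$ is the value of the functional induced by $\rho^{(2)}$ at the distribution of $c(z,Y)$ when $Y\sim P_{Y|X=x}$. $\|\cdot\|^{q}$-weak topology ($q\ge 0$). On the set $\mathcal M^q_d$ of probability measures on $\mathbb R^d$ with $\int\|t\|^q\,P(dt)<\infty$, it is the coarsest topology making $P\mapsto\int h\,dP$ continuous for every continuous $h:\mathbb R^d\to\mathbb R$ satisfying $|h(t)|\le c_0(\|t\|^q+1)$ for all $t$ and some constant $c_0>0$. Assumption (d) includes that $P_{Y|X=x}\in\mathcal M^{\iota p}_{d_y}$ for every $x$. *)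

theory Defs
  imports "HOL-Probability.Probability"
begin

definition nonatomic :: "'w measure \<Rightarrow> bool" where
  "nonatomic M \<longleftrightarrow>
     (\<forall>A\<in>sets M. emeasure M A > 0 \<longrightarrow>
        (\<exists>B\<in>sets M. B \<subseteq> A \<and> 0 < emeasure M B \<and> emeasure M B < emeasure M A))"

text \<open>Elements of \<open>Lp_space M p\<close> are functions, not almost-everywhere classes; a monotone
  functional on them takes equal values on almost everywhere equal functions.\<close>

definition Lp_space :: "'w measure \<Rightarrow> real \<Rightarrow> ('w \<Rightarrow> real) set" where
  "Lp_space M p = {\<xi>. \<xi> \<in> borel_measurable M \<and> integrable M (\<lambda>\<omega>. \<bar>\<xi> \<omega>\<bar> powr p)}"

definition convex_risk_measure :: "'w measure \<Rightarrow> real \<Rightarrow> (('w \<Rightarrow> real) \<Rightarrow> real) \<Rightarrow> bool" where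
  "convex_risk_measure M p \<rho> \<longleftrightarrow>
     (\<forall>\<xi>\<in>Lp_space M p. \<forall>\<zeta>\<in>Lp_space M p. (AE \<omega> in M. \<xi> \<omega> \<ge> \<zeta> \<omega>) \<longrightarrow> \<rho> \<xi> \<ge> \<rho> \<zeta>) \<and>
     (\<forall>\<xi>\<in>Lp_space M p. \<forall>a. \<rho> (\<lambda>\<omega>. \<xi> \<omega> + a) = \<rho> \<xi> + a) \<and>
     (\<forall>\<xi>\<in>Lp_space M p. \<forall>\<zeta>\<in>Lp_space M p. \<forall>t\<in>{0..1}.
        \<rho> (\<lambda>\<omega>. t * \<xi> \<omega> + (1 - t) * \<zeta> \<omega>) \<le> t * \<rho> \<xi> + (1 - t) * \<rho> \<zeta>)"

definition law_invariant :: "'w measure \<Rightarrow> real \<Rightarrow> (('w \<Rightarrow> real) \<Rightarrow> real) \<Rightarrow> bool" where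
  "law_invariant M p \<rho> \<longleftrightarrow>
     (\<forall>\<xi>\<in>Lp_space M p. \<forall>\<zeta>\<in>Lp_space M p. distr M borel \<xi> = distr M borel \<zeta> \<longrightarrow> \<rho> \<xi> = \<rho> \<zeta>)"

text \<open>The value of \<open>quantile \<mu> u\<close> is meaningful for \<open>0 < u < 1\<close> only. For other \<open>u\<close>, the infimum may
  be over an empty or unbounded set; a uniform random variable takes such values with
  probability 0.\<close>

definition quantile :: "real measure \<Rightarrow> real \<Rightarrow> real" where
  "quantile \<mu> u = Inf {x. u \<le> cdf \<mu> x}"

definition uniform01 :: "'w measure \<Rightarrow> ('w \<Rightarrow> real) \<Rightarrow> bool" where
  "uniform01 M U \<longleftrightarrow>
     U \<in> borel_measurable M \<and> distr M borel U = uniform_measure lborel {0..1}"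

text \<open>A uniform \<open>U\<close> exists on every nonatomic probability space, and for law-invariant \<open>\<rho>\<close> its choice
  does not matter.\<close>

definition induced_functional ::
    "'w measure \<Rightarrow> (('w \<Rightarrow> real) \<Rightarrow> real) \<Rightarrow> real measure \<Rightarrow> real" where
  "induced_functional M \<rho> \<mu> = \<rho> (\<lambda>\<omega>. quantile \<mu> ((SOME U. uniform01 M U) \<omega>))"

text \<open>Usually written \<open>\<rho>\<close> with subscript \<open>Q\<close> applied to \<open>\<phi> W\<close>, where \<open>W\<close> has law \<open>Q\<close>.\<close>

definition risk_under ::
    "'w measure \<Rightarrow> (('w \<Rightarrow> real) \<Rightarrow> real) \<Rightarrow> 'a measure \<Rightarrow> ('a \<Rightarrow> real) \<Rightarrow> real" where
  "risk_under M \<rho> Q \<phi> = induced_functional M \<rho> (distr Q borel \<phi>)"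

text \<open>Unlike \<open>powr\<close>, for which \<open>0 powr 0 = 0\<close>, this power satisfies \<open>rpow 0 0 = 1\<close>.\<close>

definition rpow :: "real \<Rightarrow> real \<Rightarrow> real" where
  "rpow t q = (if q = 0 then 1 else t powr q)"

definition moment_measures :: "real \<Rightarrow> 'a::euclidean_space measure set" where
  "moment_measures q =
     {P. sets P = sets borel \<and> prob_space P \<and> integrable P (\<lambda>t. rpow (norm t) q)}"

definition norm_weak_test :: "real \<Rightarrow> ('a::euclidean_space \<Rightarrow> real) set" where
  "norm_weak_test q =
     {h. continuous_on UNIV h \<and> (\<exists>c0>0. \<forall>t. \<bar>h t\<bar> \<le> c0 * (rpow (norm t) q + 1))}"

definition norm_weak_topology :: "real \<Rightarrow> 'a::euclidean_space measure topology" where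
  "norm_weak_topology q =
     topology_generated_by
       {{P \<in> moment_measures q. integral\<^sup>L P h \<in> V} | h V. h \<in> norm_weak_test q \<and> open V}"

definition polish_subspace :: "'a::euclidean_space set \<Rightarrow> bool" where
  "polish_subspace S \<longleftrightarrow>
     completely_metrizable_space (top_of_set S) \<and>
     (\<exists>D. countable D \<and> D \<subseteq> S \<and> S \<subseteq> closure D)"

definition locally_bounded_on :: "'a::topological_space set \<Rightarrow> ('a \<Rightarrow> real) \<Rightarrow> bool" where
  "locally_bounded_on S f \<longleftrightarrow> (\<forall>z\<in>S. \<exists>U. open U \<and> z \<in> U \<and> bounded (f ` (U \<inter> S)))"

text \<open>\<open>K\<close> is a version of the family of conditional distributions of \<open>Y\<close> given \<open>X = x\<close>, i.e. a
  probability kernel from \<open>A\<close> to \<open>B\<close> disintegrating the joint law of \<open>(X, Y)\<close> under \<open>N\<close>.\<close>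

definition conditional_distribution ::
    "'v measure \<Rightarrow> 'a measure \<Rightarrow> 'b measure \<Rightarrow> ('v \<Rightarrow> 'a) \<Rightarrow> ('v \<Rightarrow> 'b) \<Rightarrow> ('a \<Rightarrow> 'b measure) \<Rightarrow> bool" where
  "conditional_distribution N A B X Y K \<longleftrightarrow>
     K \<in> A \<rightarrow>\<^sub>M prob_algebra B \<and>
     (\<forall>S\<in>sets A. \<forall>T\<in>sets B.
        emeasure N (X -` S \<inter> Y -` T \<inter> space N) = (\<integral>\<^sup>+x\<in>S. emeasure (K x) T \<partial>distr N A X))"

definition extend_measure_borel :: "'a::euclidean_space measure \<Rightarrow> 'a measure" where
  "extend_measure_borel P = distr P borel (\<lambda>y. y)"

end

theory Submission
  imports Defs
begin

text \<open>
  Let \<open>x\<^sub>n\<close> tend to \<open>x\<close>. The laws of \<open>c (g x\<^sub>n) Y\<close> under the conditional distributions at \<open>x\<^sub>n\<close> converge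
  weakly and with their \<open>p\<close>-th absolute moments. Their quantile functions, evaluated at one uniform
  variable \<open>U\<close>, therefore converge almost surely, and by Scheffe's lemma also in \<open>L\<^sup>p\<close>. It remains to
  see that a finite-valued convex risk measure is continuous on \<open>L\<^sup>p\<close>: if \<open>\<zeta>\<^sub>k\<close> tends to 0 fast enough,
  then all \<open>2\<^sup>k \<bar>\<zeta>\<^sub>k\<bar>\<close> are dominated by a single \<open>\<eta>\<close> in \<open>L\<^sup>p\<close>, and convexity along the segment from
  \<open>\<xi>\<close> to \<open>\<xi> + \<eta>\<close> bounds \<open>\<bar>\<rho> (\<xi> + \<zeta>\<^sub>k) - \<rho> \<xi>\<bar>\<close> by a multiple of \<open>2\<^sup>-\<^sup>k\<close>.

  The variable \<open>U\<close> comes from a maximal chain of events, whose probabilities fill the whole unit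
  interval because the space is nonatomic.
\<close>

section \<open>Uniform random variables on nonatomic spaces\<close>

text \<open>Comparable members of the chain are required to have different measures: in a chain for
  inclusion alone, the members of one given measure may have a non-measurable union.\<close>
lemma (in finite_measure) nonatomic_maximal_chain:
  assumes na: "nonatomic M"
    and mc: "pred_on.maxchain (sets M) (\<lambda>A B. A \<subseteq> B \<and> measure M A < measure M B) \<C>"
    and t: "0 \<le> t" "t \<le> measure M (space M)"
  shows "\<exists>C\<in>\<C>. measure M C = t"
proof (rule ccontr)
  assume neg: "\<not> ?thesis"
  let ?lt = "\<lambda>A B. A \<subseteq> B \<and> measure M A < measure M B"
  interpret pred_on "sets M" ?lt .
  have ch: "chain \<C>" using mc maxchain_imp_chain by blast
  have sub: "\<C> \<subseteq> sets M" using ch by (auto simp: chain_def)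
  have comp: "A \<subseteq> B" if "A \<in> \<C>" "B \<in> \<C>" "measure M A \<le> measure M B" for A B
    using chain_total[OF ch that(1,2)] that(3) by auto
  \<comment> \<open>Maximality of the chain enters here. Each contradiction below comes from a set
    that is forced into \<open>\<C>\<close> in this way.\<close>
  have ext: "D \<in> \<C>" if "D \<in> sets M" "\<And>C. C \<in> \<C> \<Longrightarrow> ?lt C D \<or> ?lt D C" for D
  proof (rule ccontr)
    assume "D \<notin> \<C>"
    moreover have "chain (insert D \<C>)"
      using ch that by (auto simp: chain_def)
    ultimately show False using mc unfolding maxchain_def by blast
  qed
  have ex0: "\<exists>C\<in>\<C>. measure M C = 0"
  proof (rule ccontr)
    assume no: "\<not> (\<exists>C\<in>\<C>. measure M C = 0)"
    then have "{} \<in> \<C>"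
      by (intro ext) (auto simp: less_le)
    then show False using no by auto
  qed
  have ex1: "\<exists>C\<in>\<C>. measure M C = measure M (space M)"
  proof (rule ccontr)
    assume no: "\<not> (\<exists>C\<in>\<C>. measure M C = measure M (space M))"
    then have "space M \<in> \<C>"
      using sub sets.sets_into_space[of _ M] bounded_measure by (intro ext) (auto simp: less_le subset_iff)
    then show False using no by auto
  qed
  \<comment> \<open>The level \<open>t\<close> cuts the chain into \<open>L\<close> and
    \<open>R\<close>. First the extreme values \<open>s\<close> and \<open>r\<close> are shown to be
    attained, then the gap between them is split.\<close>
  define L where "L = {C\<in>\<C>. measure M C < t}"
  define R where "R = {C\<in>\<C>. measure M C > t}"
  have L: "L \<noteq> {}"
  proof -
    obtain C where C: "C \<in> \<C>" "measure M C = 0" using ex0 by blast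
    then have "measure M C < t" using neg t(1) by (metis order_le_less)
    then show ?thesis using C by (auto simp: L_def)
  qed
  have R: "R \<noteq> {}"
  proof -
    obtain C where C: "C \<in> \<C>" "measure M C = measure M (space M)" using ex1 by blast
    then have "measure M C > t" using neg t(2) by (metis order_le_less)
    then show ?thesis using C by (auto simp: R_def)
  qed
  have LR: "C \<in> L \<or> C \<in> R" if "C \<in> \<C>" for C using neg that by (auto simp: L_def R_def neq_iff)
  define s where "s = (SUP C\<in>L. measure M C)"
  define r where "r = (INF C\<in>R. measure M C)"
  have bL: "bdd_above (measure M ` L)" by (auto simp: L_def intro!: bdd_aboveI[of _ t])
  have bR: "bdd_below (measure M ` R)" by (auto intro!: bdd_belowI[of _ 0])
  have sle: "measure M C \<le> s" if "C \<in> L" for C using that bL by (auto simp: s_def intro: cSUP_upper)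
  have rge: "r \<le> measure M C" if "C \<in> R" for C using that bR by (auto simp: r_def intro: cINF_lower)
  have st: "s \<le> t" unfolding s_def using L by (intro cSUP_least) (auto simp: L_def)
  have tr: "t \<le> r" unfolding r_def using R by (intro cINF_greatest) (auto simp: R_def)
  \<comment> \<open>If \<open>s\<close> were not attained, the union \<open>D\<close> of a sequence
    in \<open>L\<close> with measures tending to \<open>s\<close> would lie strictly above every
    member of \<open>L\<close> and strictly below every member of \<open>R\<close>. Maximality would
    put it into \<open>L\<close>, hence strictly below itself.\<close>
  have B1: "\<exists>B\<in>\<C>. measure M B = s"
  proof (rule ccontr)
    assume no: "\<not> ?thesis"
    have "s \<in> closure (measure M ` L)" unfolding s_def using L bL by (intro closure_contains_Sup) auto
    then obtain f where f: "\<And>n. f n \<in> measure M ` L" "f \<longlonglongrightarrow> s"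
      unfolding closure_sequential by blast
    have "\<forall>n. \<exists>C. C \<in> L \<and> f n = measure M C" using f(1) by (auto simp: image_iff)
    from choice[OF this] obtain C where C: "\<And>n. C n \<in> L" "\<And>n. f n = measure M (C n)" by blast
    define D where "D = (\<Union>n. C n)"
    have CC: "C n \<in> \<C>" for n using C by (auto simp: L_def)
    have Dm: "D \<in> sets M" using CC sub by (auto simp: D_def)
    have below: "?lt A D" if A: "A \<in> L" for A
    proof -
      have "measure M A < s" using sle[OF A] no A by (auto simp: L_def less_le)
      then obtain n where n: "measure M A < measure M (C n)"
        using order_tendstoD(1)[OF f(2)] C(2) by (metis eventually_happens sequentially_bot)
      then have "A \<subseteq> C n" using comp A CC by (auto simp: L_def)
      moreover have "measure M (C n) \<le> measure M D"
        using Dm by (intro finite_measure_mono) (auto simp: D_def)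
      ultimately show ?thesis using n by (auto simp: D_def)
    qed
    have "measure M D \<le> s"
    proof -
      \<comment> \<open>The sequence need not be monotone, but in a chain a finite union is one of
        its terms. Continuity from below then passes the bound to \<open>D\<close>.\<close>
      have "measure M (\<Union>i\<le>n. C i) \<le> s" for n
      proof -
        have "\<exists>m\<le>n. (\<Union>i\<le>n. C i) = C m"
        proof (induction n)
          case (Suc n)
          then obtain m where m: "m \<le> n" "(\<Union>i\<le>n. C i) = C m" by blast
          have "C m \<subseteq> C (Suc n) \<or> C (Suc n) \<subseteq> C m"
            using chain_total[OF ch CC CC] by auto
          then show ?case using m
            by (metis Un_absorb1 Un_absorb2 SUP_insert atMost_Suc le_Suc_eq Un_commute)
        qed auto
        then show ?thesis using sle C(1) by metis
      qed
      moreover have "(\<lambda>n. measure M (\<Union>i\<le>n. C i)) \<longlonglongrightarrow> measure M (\<Union>n. \<Union>i\<le>n. C i)"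
        using CC sub by (intro finite_Lim_measure_incseq) (auto simp: incseq_def, force)
      moreover have "(\<Union>n. \<Union>i\<le>n. C i) = D" by (auto simp: D_def)
      ultimately show ?thesis by (metis LIMSEQ_le_const2)
    qed
    have "D \<in> \<C>"
    proof (rule ext[OF Dm])
      fix A assume A: "A \<in> \<C>"
      show "?lt A D \<or> ?lt D A"
      proof (cases "A \<in> L")
        case False
        then have "A \<in> R" using LR A by blast
        then have "measure M A > t" by (auto simp: R_def)
        then have "C n \<subseteq> A" for n using C(1)[of n] comp[OF CC A, of n] by (auto simp: L_def)
        then show ?thesis using \<open>measure M D \<le> s\<close> st \<open>measure M A > t\<close> by (auto simp: D_def)
      qed (use below in blast)
    qed
    then have "D \<in> L" using \<open>measure M D \<le> s\<close> st neg unfolding L_def by (metis (mono_tags, lifting) mem_Collect_eq order_le_less order_trans)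
    then show False using below by blast
  qed
  \<comment> \<open>The mirror image of the previous argument, with intersections in place of unions
    and continuity from above.\<close>
  have B2: "\<exists>B\<in>\<C>. measure M B = r"
  proof (rule ccontr)
    assume no: "\<not> ?thesis"
    have "r \<in> closure (measure M ` R)" unfolding r_def using R bR by (intro closure_contains_Inf) auto
    then obtain f where f: "\<And>n. f n \<in> measure M ` R" "f \<longlonglongrightarrow> r"
      unfolding closure_sequential by blast
    have "\<forall>n. \<exists>C. C \<in> R \<and> f n = measure M C" using f(1) by (auto simp: image_iff)
    from choice[OF this] obtain C where C: "\<And>n. C n \<in> R" "\<And>n. f n = measure M (C n)" by blast
    define D where "D = (\<Inter>n. C n)"
    have CC: "C n \<in> \<C>" for n using C by (auto simp: R_def)
    have Cm: "C n \<in> sets M" for n using CC sub by auto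
    have Dm: "D \<in> sets M" using Cm by (auto simp: D_def)
    have above: "?lt D A" if A: "A \<in> R" for A
    proof -
      have "r < measure M A" using rge[OF A] no A by (auto simp: R_def less_le)
      then obtain n where n: "measure M (C n) < measure M A"
        using order_tendstoD(2)[OF f(2)] C(2) by (metis eventually_happens sequentially_bot)
      then have "C n \<subseteq> A" using comp A CC by (auto simp: R_def)
      moreover have "measure M D \<le> measure M (C n)"
        using Cm by (intro finite_measure_mono) (auto simp: D_def)
      ultimately show ?thesis using n by (auto simp: D_def)
    qed
    have "r \<le> measure M D"
    proof -
      have "r \<le> measure M (\<Inter>i\<le>n. C i)" for n
      proof -
        have "\<exists>m\<le>n. (\<Inter>i\<le>n. C i) = C m"
        proof (induction n)
          case (Suc n)
          then obtain m where m: "m \<le> n" "(\<Inter>i\<le>n. C i) = C m" by blast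
          have "C m \<subseteq> C (Suc n) \<or> C (Suc n) \<subseteq> C m"
            using chain_total[OF ch CC CC] by auto
          then show ?case using m
            by (metis Int_absorb1 Int_absorb2 INF_insert atMost_Suc le_Suc_eq Int_commute)
        qed auto
        then show ?thesis using rge C(1) by metis
      qed
      moreover have "(\<lambda>n. measure M (\<Inter>i\<le>n. C i)) \<longlonglongrightarrow> measure M (\<Inter>n. \<Inter>i\<le>n. C i)"
        using Cm by (intro finite_Lim_measure_decseq) (auto simp: decseq_def)
      moreover have "(\<Inter>n. \<Inter>i\<le>n. C i) = D" by (auto simp: D_def)
      ultimately show ?thesis by (metis LIMSEQ_le_const)
    qed
    have "D \<in> \<C>"
    proof (rule ext[OF Dm])
      fix A assume A: "A \<in> \<C>"
      show "?lt A D \<or> ?lt D A"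
      proof (cases "A \<in> R")
        case False
        then have "A \<in> L" using LR A by blast
        then have "measure M A < t" by (auto simp: L_def)
        then have "A \<subseteq> C n" for n using C(1)[of n] comp[OF A CC, of n] by (auto simp: R_def)
        then show ?thesis using \<open>r \<le> measure M D\<close> tr \<open>measure M A < t\<close> by (auto simp: D_def)
      qed (use above in blast)
    qed
    then have "D \<in> R" using \<open>r \<le> measure M D\<close> tr neg unfolding R_def by (metis (mono_tags, lifting) mem_Collect_eq order_le_less order_trans)
    then show False using above by blast
  qed
  obtain B1 B2 where B: "B1 \<in> \<C>" "measure M B1 = s" "B2 \<in> \<C>" "measure M B2 = r"
    using B1 B2 by blast
  have "s < t" "t < r" using B neg st tr by (metis order_le_less)+
  have Bm: "B1 \<in> sets M" "B2 \<in> sets M" using B sub by auto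
  have B12: "B1 \<subseteq> B2" using comp B \<open>s < t\<close> \<open>t < r\<close> by auto
  have mD: "measure M (B2 - B1) = r - s" using B Bm B12 by (simp add: finite_measure_Diff)
  \<comment> \<open>Nonatomicity splits the difference of the two extreme sets. Adjoining the
    smaller part \<open>E\<close> to \<open>B1\<close> gives a set comparable with every member of
    the chain, of measure strictly between \<open>s\<close> and \<open>r\<close>, where no member
    can be.\<close>
  then obtain E where E: "E \<in> sets M" "E \<subseteq> B2 - B1" "0 < measure M E" "measure M E < r - s"
    using na[unfolded nonatomic_def, rule_format, of "B2 - B1"] Bm \<open>s < t\<close> \<open>t < r\<close>
    by (auto simp: emeasure_eq_measure ennreal_less_iff)
  define D where "D = B1 \<union> E"
  have Dm: "D \<in> sets M" using E Bm by (auto simp: D_def)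
  have mD: "measure M D = s + measure M E"
    unfolding D_def B(2)[symmetric] using E Bm by (intro finite_measure_Union) auto
  have "D \<in> \<C>"
  proof (rule ext[OF Dm])
    fix A assume A: "A \<in> \<C>"
    show "?lt A D \<or> ?lt D A"
    proof (cases "A \<in> L")
      case True
      then show ?thesis using sle[OF True] comp[OF A B(1)] B mD E by (auto simp: D_def)
    next
      case False
      then have "A \<in> R" using LR A by blast
      then show ?thesis using rge comp[OF B(3) A] B mD E B12 by (fastforce simp: D_def)
    qed
  qed
  then show False using LR sle[of D] rge[of D] mD E by auto
qed

text \<open>A maximal chain has a member of every probability. Comparability within the chain turns
  the order of the levels into inclusion of the chosen members.\<close>

lemma (in prob_space) nonatomic_increasing_events:
  assumes "nonatomic M"
  obtains B where "\<And>t. t \<in> {0..1} \<Longrightarrow> B t \<in> sets M" "\<And>t. t \<in> {0..1} \<Longrightarrow> prob (B t) = t"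
    "\<And>s t. 0 \<le> s \<Longrightarrow> s \<le> t \<Longrightarrow> t \<le> 1 \<Longrightarrow> B s \<subseteq> B t"
proof -
  interpret pred_on "sets M" "\<lambda>A B. A \<subseteq> B \<and> prob A < prob B" .
  obtain \<C> where mc: "maxchain \<C>" using Hausdorff by blast
  then have ch: "chain \<C>" by (rule maxchain_imp_chain)
  have "\<forall>t\<in>{0..1}. \<exists>C\<in>\<C>. prob C = t"
    using nonatomic_maximal_chain[OF assms mc] by (auto simp: prob_space)
  then obtain B where B: "\<And>t. t \<in> {0..1} \<Longrightarrow> B t \<in> \<C> \<and> prob (B t) = t" by metis
  show ?thesis
  proof
    show "B s \<subseteq> B t" if "0 \<le> s" "s \<le> t" "t \<le> 1" for s t
      using chain_total[OF ch, of "B s" "B t"] B[of s] B[of t] that by (cases "s = t") auto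
  qed (use B ch in \<open>auto simp: chain_def\<close>)
qed

lemma cdf_uniform_measure_01: "cdf (uniform_measure lborel {0..1::real}) x = max 0 (min 1 x)"
proof -
  have "cdf (uniform_measure lborel {0..1::real}) x = measure lborel ({0..1} \<inter> {..x})"
    by (simp add: cdf_def measure_uniform_measure)
  also have "{0..1} \<inter> {..x} = {0..min 1 x}" by auto
  finally show ?thesis by simp
qed

text \<open>\<open>U\<close> is the level at which a point enters the increasing family
  \<open>B\<close>. For rational \<open>q\<close> the event \<open>U < q\<close> is contained in
  \<open>B q\<close>, and on \<open>B q\<close> one has \<open>U \<le> q\<close>, so the
  distribution function of \<open>U\<close> is the identity on the unit interval.\<close>

lemma (in prob_space) uniform01_exists:
  assumes "nonatomic M"
  shows "\<exists>U. uniform01 M U"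
proof -
  obtain B where B: "\<And>t. t \<in> {0..1} \<Longrightarrow> B t \<in> sets M" "\<And>t. t \<in> {0..1} \<Longrightarrow> prob (B t) = t"
    and mono: "\<And>s t. 0 \<le> s \<Longrightarrow> s \<le> t \<Longrightarrow> t \<le> 1 \<Longrightarrow> B s \<subseteq> B t"
    using nonatomic_increasing_events[OF assms] by blast
  define I where "I = \<rat> \<inter> {0..1::real}"
  \<comment> \<open>Rational levels keep the infimum countable and \<open>U\<close> measurable. The
    default 1 covers points outside every \<open>B q\<close>, since \<open>B 1\<close> is only known
    to have probability 1.\<close>
  define U where "U \<omega> = (INF q\<in>I. if \<omega> \<in> B q then q else 1)" for \<omega>
  have I: "countable I" "I \<noteq> {}" "1 \<in> I" "I \<subseteq> {0..1}" by (auto simp: I_def countable_rat)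
  have bdd: "bdd_below ((\<lambda>q. if \<omega> \<in> B q then q else 1) ` I)" for \<omega>
    using I by (auto intro!: bdd_belowI[of _ 0])
  have [measurable]: "U \<in> borel_measurable M"
    unfolding U_def using I B bdd by (intro borel_measurable_cINF_real) (auto intro!: measurable_If)
  have U0: "0 \<le> U \<omega>" for \<omega> unfolding U_def using I by (intro cINF_greatest) auto
  have U1: "U \<omega> \<le> 1" for \<omega>
    unfolding U_def using I(3) by (intro cINF_lower2[OF bdd, of 1]) auto
  have Ule: "U \<omega> \<le> q" if "q \<in> I" "\<omega> \<in> B q" for \<omega> q
    unfolding U_def using that by (intro cINF_lower2[OF bdd, of q]) auto
  have Uge: "\<omega> \<in> B q" if q: "q \<in> I" "U \<omega> < q" for \<omega> q
  proof -
    have "\<exists>x\<in>(\<lambda>q. if \<omega> \<in> B q then q else 1) ` I. x < q"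
      using q(2) I(2) unfolding U_def by (intro cInf_lessD) auto
    then obtain r where "r \<in> I" "(if \<omega> \<in> B r then r else 1) < q"
      by (elim bexE imageE) simp
    moreover have "0 \<le> r" "q \<le> 1" using q(1) \<open>r \<in> I\<close> I(4) by auto
    ultimately have "\<omega> \<in> B r" "r < q" by (auto split: if_splits)
    then show ?thesis using mono[of r q] \<open>0 \<le> r\<close> \<open>q \<le> 1\<close> by auto
  qed
  have cdfU: "prob {\<omega>\<in>space M. U \<omega> \<le> x} = max 0 (min 1 x)" for x
  proof -
    consider "x < 0" | "0 \<le> x" "x < 1" | "1 \<le> x" by linarith
    then show ?thesis
    proof cases
      case 1
      then have "{\<omega>\<in>space M. U \<omega> \<le> x} = {}" using U0 by (auto simp: not_le intro: less_le_trans)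
      then show ?thesis using 1 by (simp del: Collect_empty_eq)
    next
      case 3
      then have "{\<omega>\<in>space M. U \<omega> \<le> x} = space M" using U1 by (auto intro: order_trans)
      then show ?thesis using 3 by (simp add: prob_space del: Collect_conv_if)
    next
      case 2
      \<comment> \<open>The event lies inside \<open>B q\<close> for rational \<open>q > x\<close>
        and contains \<open>B q\<close> for rational \<open>q < x\<close>. Density of the rationals
        squeezes its probability to \<open>x\<close>.\<close>
      have "prob {\<omega>\<in>space M. U \<omega> \<le> x} \<le> x"
      proof (rule dense_ge_bounded[OF 2(2)])
        fix z assume z: "x < z" "z < 1"
        obtain q where q: "q \<in> \<rat>" "x < q" "q < z" using Rats_dense_in_real z by blast
        then have "q \<in> I" using z 2 by (auto simp: I_def)
        then have "{\<omega>\<in>space M. U \<omega> \<le> x} \<subseteq> B q" using q by (auto intro!: Uge)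
        then have "prob {\<omega>\<in>space M. U \<omega> \<le> x} \<le> prob (B q)"
          using \<open>q \<in> I\<close> I B by (intro finite_measure_mono) auto
        then show "prob {\<omega>\<in>space M. U \<omega> \<le> x} \<le> z" using B \<open>q \<in> I\<close> I q by force
      qed
      moreover have "x \<le> prob {\<omega>\<in>space M. U \<omega> \<le> x}"
      proof (rule field_le_epsilon)
        fix e :: real assume "0 < e"
        show "x \<le> prob {\<omega>\<in>space M. U \<omega> \<le> x} + e"
        proof (cases "x - e < 0")
          case False
          obtain q where q: "q \<in> \<rat>" "x - e < q" "q < x" using Rats_dense_in_real[of "x-e" x] \<open>0 < e\<close> by auto
          then have "q \<in> I" using False 2 by (auto simp: I_def)
          then have "B q \<subseteq> {\<omega>\<in>space M. U \<omega> \<le> x}"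
            using q Ule sets.sets_into_space[OF B(1), of q] I by fastforce
          then have "prob (B q) \<le> prob {\<omega>\<in>space M. U \<omega> \<le> x}"
            by (intro finite_measure_mono) auto
          then show ?thesis using B \<open>q \<in> I\<close> I q by force
        qed (use measure_nonneg[of M] in \<open>smt (verit)\<close>)
      qed
      ultimately show ?thesis using 2 by simp
    qed
  qed
  have "distr M borel U = uniform_measure lborel {0..1}"
  proof (rule cdf_unique)
    interpret u: prob_space "uniform_measure lborel {0..1::real}"
      by (rule prob_space_uniform_measure) auto
    show "real_distribution (uniform_measure lborel {0..1::real})" by standard auto
    show "cdf (distr M borel U) = cdf (uniform_measure lborel {0..1})"
    proof
      fix x
      have "cdf (distr M borel U) x = prob {\<omega>\<in>space M. U \<omega> \<le> x}"
        by (auto simp: cdf_def measure_distr intro!: arg_cong[where f=prob])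
      then show "cdf (distr M borel U) x = cdf (uniform_measure lborel {0..1}) x"
        by (simp only: cdf_uniform_measure_01 cdfU)
    qed
  qed auto
  then show ?thesis unfolding uniform01_def using \<open>U \<in> borel_measurable M\<close> by blast
qed

section \<open>Quantile functions\<close>

text \<open>A piecewise monotone function is Borel. On the open unit interval monotonicity is the
  usual one. For levels at most 0 the infimum is over the whole line, for levels above 1 over the
  empty set, so the function is constant on each of these pieces.\<close>

lemma quantile_measurable [measurable]:
  assumes "real_distribution \<mu>"
  shows "quantile \<mu> \<in> borel_measurable borel"
proof -
  interpret cdf_distribution \<mu> using assms by (simp add: cdf_distribution_def)
  have "mono_on {0<..<1} (quantile \<mu>)" using mono_I by (simp add: quantile_def[abs_def])
  moreover have "mono_on {..0} (quantile \<mu>)"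
  proof -
    have "{x. u \<le> cdf \<mu> x} = UNIV" if "u \<le> 0" for u using that cdf_nonneg order_trans by blast
    then show ?thesis by (auto simp: mono_on_def quantile_def)
  qed
  moreover have "mono_on {1} (quantile \<mu>)" by (auto simp: mono_on_def)
  moreover have "mono_on {1<..} (quantile \<mu>)"
  proof -
    have "{x. u \<le> cdf \<mu> x} = {}" if "u > 1" for u 
      using that cdf_bounded_prob less_le_trans not_le by (metis (mono_tags, lifting) Collect_empty_eq)
    then show ?thesis by (auto simp: mono_on_def quantile_def)
  qed
  ultimately show ?thesis
    by (intro borel_measurable_piecewise_mono[of "{{0<..<1}, {..0}, {1}, {1<..}}"]) auto
qed

text \<open>The end points form a null set. This passes from the closed interval in
  \<open>uniform01\<close> to the open one in \<open>distr_I_eq_M\<close>.\<close>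

lemma distr_restrict_space_eq_uniform:
  assumes [measurable]: "f \<in> borel_measurable borel"
  shows "distr (uniform_measure lborel {0..1::real}) borel f = distr (restrict_space lborel {0<..<1}) borel f"
proof (rule measure_eqI)
  fix A assume "A \<in> sets (distr (uniform_measure lborel {0..1::real}) borel f)"
  then have [measurable]: "A \<in> sets borel" by simp
  have m: "f -` A \<in> sets borel" using measurable_sets[OF assms, of A] by simp
  have "emeasure (distr (uniform_measure lborel {0..1::real}) borel f) A = emeasure lborel ({0..1} \<inter> f -` A)"
    using m by (simp add: emeasure_distr divide_ennreal_def)
  also have "\<dots> = emeasure lborel ({0<..<1} \<inter> f -` A)"
  proof (rule emeasure_eq_AE)
    show "AE x in lborel. (x \<in> {0..1} \<inter> f -` A) = (x \<in> {0<..<1} \<inter> f -` A)"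
      using AE_lborel_singleton[of 0] AE_lborel_singleton[of 1] by eventually_elim auto
  qed (use m in auto)
  also have "\<dots> = emeasure (distr (restrict_space lborel {0<..<1}) borel f) A"
    using m by (subst emeasure_distr)
      (auto simp: emeasure_restrict_space space_restrict_space measurable_restrict_space1 Int_commute)
  finally show "emeasure (distr (uniform_measure lborel {0..1::real}) borel f) A = emeasure (distr (restrict_space lborel {0<..<1}) borel f) A" .
qed simp

text \<open>Inverse transform sampling, obtained from the law of the quantile function under
  Lebesgue measure on the open unit interval.\<close>

lemma distr_quantile_uniform:
  assumes U: "uniform01 M U" and \<mu>: "real_distribution \<mu>"
  shows "distr M borel (\<lambda>\<omega>. quantile \<mu> (U \<omega>)) = \<mu>"
proof -
  interpret cdf_distribution \<mu> using \<mu> by (simp add: cdf_distribution_def)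
  note [measurable] = quantile_measurable[OF \<mu>]
  have [measurable]: "U \<in> borel_measurable M" using U by (simp add: uniform01_def)
  have "distr M borel (\<lambda>\<omega>. quantile \<mu> (U \<omega>)) = distr (distr M borel U) borel (quantile \<mu>)"
    by (simp add: distr_distr comp_def)
  also have "\<dots> = distr (uniform_measure lborel {0..1}) borel (quantile \<mu>)"
    using U by (simp add: uniform01_def)
  also have "\<dots> = \<mu>"
    using distr_I_eq_M distr_restrict_space_eq_uniform[OF quantile_measurable[OF \<mu>]]
    by (simp add: quantile_def[abs_def])
  finally show ?thesis .
qed

text \<open>The equivalence of \<open>v \<le> cdf \<nu> x\<close> and
  \<open>quantile \<nu> v \<le> x\<close> carries convergence of distribution functions over to
  quantiles. A law has only countably many atoms, so points \<open>x\<close> without mass are dense,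
  and at these the distribution functions converge.\<close>

lemma quantile_tendsto:
  assumes \<mu>: "\<And>n. real_distribution (\<mu> n)" and \<nu>: "real_distribution \<nu>"
    and wc: "weak_conv_m \<mu> \<nu>" and u: "0 < u" "u < 1" and cont: "isCont (quantile \<nu>) u"
  shows "(\<lambda>n. quantile (\<mu> n) u) \<longlonglongrightarrow> quantile \<nu> u"
proof -
  interpret \<mu>: cdf_distribution "\<mu> n" for n unfolding cdf_distribution_def by (rule \<mu>)
  interpret \<nu>: cdf_distribution \<nu> using \<nu> by (simp add: cdf_distribution_def)
  have q\<mu>: "v \<le> cdf (\<mu> n) x \<longleftrightarrow> quantile (\<mu> n) v \<le> x" if "0 < v" "v < 1" for n v x
    unfolding quantile_def by (rule \<mu>.pseudoinverse[OF that])
  have q\<nu>: "v \<le> cdf \<nu> x \<longleftrightarrow> quantile \<nu> v \<le> x" if "0 < v" "v < 1" for v x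
    unfolding quantile_def by (rule \<nu>.pseudoinverse[OF that])
  have conv: "(\<lambda>n. cdf (\<mu> n) x) \<longlonglongrightarrow> cdf \<nu> x" if "measure \<nu> {x} = 0" for x
    using wc that \<nu>.isCont_cdf by (auto simp: weak_conv_m_def weak_conv_def)
  have ex: "\<exists>x. a < x \<and> x < b \<and> measure \<nu> {x} = 0" if "a < b" for a b
    using open_minus_countable[OF \<nu>.countable_support, of "{a<..<b}"] that by auto
  show ?thesis
  proof (rule order_tendstoI)
    fix a assume "a < quantile \<nu> u"
    then obtain x where x: "a < x" "x < quantile \<nu> u" "measure \<nu> {x} = 0" using ex by blast
    then have "cdf \<nu> x < u" using q\<nu>[OF u, of x] by simp
    from order_tendstoD(2)[OF conv[OF x(3)] this]
    show "\<forall>\<^sub>F n in sequentially. a < quantile (\<mu> n) u"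
      by eventually_elim (use q\<mu>[OF u, of _ x] x(1) in \<open>smt (verit)\<close>)
  next
    fix b assume b: "quantile \<nu> u < b"
    \<comment> \<open>The upper bound needs the strict inequality \<open>u < cdf \<nu> x\<close>.
      Continuity supplies a level \<open>v > u\<close> with quantile still below \<open>b\<close>,
      and \<open>v \<le> cdf \<nu> x\<close> then gives it.\<close>
    have "(quantile \<nu> \<longlongrightarrow> quantile \<nu> u) (at_right u)"
      using cont unfolding isCont_def by (rule tendsto_within_subset) simp
    from order_tendstoD(2)[OF this b] have "\<forall>\<^sub>F v in at_right u. quantile \<nu> v < b \<and> v < 1 \<and> u < v"
      using u eventually_at_right_less[of u] order_tendstoD(2)[OF tendsto_ident_at, of u 1 "{u<..}"]
      by (intro eventually_conj) auto
    then obtain v where v: "quantile \<nu> v < b" "v < 1" "u < v" 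
      by (metis (mono_tags, lifting) eventually_happens trivial_limit_at_right_real)
    then obtain x where x: "quantile \<nu> v < x" "x < b" "measure \<nu> {x} = 0" using ex by blast
    then have "u < cdf \<nu> x" using q\<nu>[of v x] u v by simp
    from order_tendstoD(1)[OF conv[OF x(3)] this]
    show "\<forall>\<^sub>F n in sequentially. quantile (\<mu> n) u < b"
      by eventually_elim (use q\<mu>[OF u, of _ x] x(2) in \<open>smt (verit)\<close>)
  qed
qed

text \<open>A monotone function has only countably many discontinuities, so a uniform variable
  almost surely avoids those of the limiting quantile function, as well as 0 and 1.\<close>

lemma AE_quantile_tendsto:
  assumes \<mu>: "\<And>n. real_distribution (\<mu> n)" and \<nu>: "real_distribution \<nu>"
    and wc: "weak_conv_m \<mu> \<nu>" and U: "uniform01 M U"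
  shows "AE \<omega> in M. (\<lambda>n. quantile (\<mu> n) (U \<omega>)) \<longlonglongrightarrow> quantile \<nu> (U \<omega>)"
proof -
  interpret cdf_distribution \<nu> using \<nu> by (simp add: cdf_distribution_def)
  have [measurable]: "U \<in> borel_measurable M" using U by (simp add: uniform01_def)
  let ?D = "{u\<in>{0<..<1}. \<not> isCont (quantile \<nu>) u}"
  have "mono_on {0<..<1} (quantile \<nu>)" using mono_I by (simp add: quantile_def[abs_def])
  then have D: "countable ?D" by (intro mono_on_ctble_discont_open) auto
  then have "countable (?D \<union> {0, 1})" by auto
  then have "AE u in lborel. u \<notin> ?D \<union> {0, 1}"
    by (intro AE_not_in countable_imp_null_set_lborel)
  then have "AE u in lborel. u \<in> {0..1} \<longrightarrow> 0 < u \<and> u < 1 \<and> isCont (quantile \<nu>) u"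
    by (rule eventually_mono) auto
  then have "AE u in uniform_measure lborel {0..1}. 0 < u \<and> u < 1 \<and> isCont (quantile \<nu>) u"
    by (intro AE_uniform_measureI) auto
  then have "AE u in distr M borel U. 0 < u \<and> u < 1 \<and> isCont (quantile \<nu>) u"
    using U by (simp only: uniform01_def)
  then have "AE \<omega> in M. 0 < U \<omega> \<and> U \<omega> < 1 \<and> isCont (quantile \<nu>) (U \<omega>)"
    by (rule AE_distrD[rotated]) simp
  then show ?thesis
    by eventually_elim (auto intro: quantile_tendsto[OF \<mu> \<nu> wc])
qed

section \<open>Convergence in \<open>L\<^sup>p\<close> and continuity of risk measures\<close>

text \<open>Bounding the sum by twice the maximum is cruder than convexity, but covers every
  exponent \<open>p \<ge> 0\<close>.\<close>

lemma powr_add_le: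
  fixes a b p :: real
  assumes "0 \<le> a" "0 \<le> b" "0 \<le> p"
  shows "(a + b) powr p \<le> 2 powr p * (a powr p + b powr p)"
proof -
  have "(a + b) powr p \<le> (2 * max a b) powr p" using assms by (intro powr_mono2) auto
  also have "\<dots> = 2 powr p * max a b powr p" using assms by (simp add: powr_mult)
  also have "\<dots> \<le> 2 powr p * (a powr p + b powr p)" by (intro mult_left_mono) (auto simp: max_def)
  finally show ?thesis .
qed

lemma Lp_space_measurable [measurable_dest]: "\<xi> \<in> Lp_space M p \<Longrightarrow> \<xi> \<in> borel_measurable M"
  by (simp add: Lp_space_def)

lemma Lp_space_add:
  assumes "\<xi> \<in> Lp_space M p" "\<zeta> \<in> Lp_space M p" "0 \<le> p"
  shows "(\<lambda>\<omega>. \<xi> \<omega> + \<zeta> \<omega>) \<in> Lp_space M p"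
proof -
  note [measurable] = assms(1,2)
  have "integrable M (\<lambda>\<omega>. 2 powr p * (\<bar>\<xi> \<omega>\<bar> powr p + \<bar>\<zeta> \<omega>\<bar> powr p))"
    using assms by (auto simp: Lp_space_def)
  then have "integrable M (\<lambda>\<omega>. \<bar>\<xi> \<omega> + \<zeta> \<omega>\<bar> powr p)"
  proof (rule Bochner_Integration.integrable_bound)
    show "AE \<omega> in M. norm (\<bar>\<xi> \<omega> + \<zeta> \<omega>\<bar> powr p) \<le> norm (2 powr p * (\<bar>\<xi> \<omega>\<bar> powr p + \<bar>\<zeta> \<omega>\<bar> powr p))"
    proof (rule AE_I2)
      fix \<omega>
      have "\<bar>\<xi> \<omega> + \<zeta> \<omega>\<bar> powr p \<le> (\<bar>\<xi> \<omega>\<bar> + \<bar>\<zeta> \<omega>\<bar>) powr p" using assms(3) by (intro powr_mono2) auto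
      also have "\<dots> \<le> 2 powr p * (\<bar>\<xi> \<omega>\<bar> powr p + \<bar>\<zeta> \<omega>\<bar> powr p)" using assms(3) by (intro powr_add_le) auto
      finally show "norm (\<bar>\<xi> \<omega> + \<zeta> \<omega>\<bar> powr p) \<le> norm (2 powr p * (\<bar>\<xi> \<omega>\<bar> powr p + \<bar>\<zeta> \<omega>\<bar> powr p))"
        by (simp add: abs_of_nonneg)
    qed
  qed measurable
  then show ?thesis by (simp add: Lp_space_def)
qed

lemma Lp_space_cmult:
  assumes "\<xi> \<in> Lp_space M p"
  shows "(\<lambda>\<omega>. a * \<xi> \<omega>) \<in> Lp_space M p"
  using assms by (auto simp: Lp_space_def abs_mult powr_mult)

lemma Lp_space_diff:
  assumes "\<xi> \<in> Lp_space M p" "\<zeta> \<in> Lp_space M p" "0 \<le> p"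
  shows "(\<lambda>\<omega>. \<xi> \<omega> - \<zeta> \<omega>) \<in> Lp_space M p"
  using Lp_space_add[OF assms(1) Lp_space_cmult[OF assms(2), of "-1"] assms(3)] by simp

text \<open>Scheffe's lemma for the \<open>p\<close>-th powers shows that \<open>b n\<close> tends
  to 0 in \<open>L\<^sup>1\<close>. The part of \<open>a n\<close> above a fixed multiple of the
  \<open>p\<close>-th power of \<open>g\<close> is controlled by \<open>b n\<close>; the truncated
  part tends to 0 by dominated convergence.\<close>

lemma Lp_convergence:
  fixes f :: "nat \<Rightarrow> 'a \<Rightarrow> real"
  assumes f: "\<And>n. f n \<in> Lp_space M p" and g: "g \<in> Lp_space M p" and p: "0 < p"
    and ae: "AE \<omega> in M. (\<lambda>n. f n \<omega>) \<longlonglongrightarrow> g \<omega>"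
    and lim: "(\<lambda>n. \<integral>\<omega>. \<bar>f n \<omega>\<bar> powr p \<partial>M) \<longlonglongrightarrow> (\<integral>\<omega>. \<bar>g \<omega>\<bar> powr p \<partial>M)"
  shows "(\<lambda>n. \<integral>\<omega>. \<bar>f n \<omega> - g \<omega>\<bar> powr p \<partial>M) \<longlonglongrightarrow> 0"
proof -
  have [measurable]: "\<And>n. f n \<in> borel_measurable M" "g \<in> borel_measurable M"
    using f g by (auto simp: Lp_space_def)
  have fi: "integrable M (\<lambda>\<omega>. \<bar>f n \<omega>\<bar> powr p)" for n using f by (auto simp: Lp_space_def)
  have gi: "integrable M (\<lambda>\<omega>. \<bar>g \<omega>\<bar> powr p)" using g by (auto simp: Lp_space_def)
  have di: "integrable M (\<lambda>\<omega>. \<bar>f n \<omega> - g \<omega>\<bar> powr p)" for n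
    using Lp_space_diff[OF f g] p by (simp add: Lp_space_def)
  define a where "a n \<omega> = \<bar>f n \<omega> - g \<omega>\<bar> powr p" for n \<omega>
  define b where "b n \<omega> = \<bar>\<bar>f n \<omega>\<bar> powr p - \<bar>g \<omega>\<bar> powr p\<bar>" for n \<omega>
  \<comment> \<open>The factor \<open>2 powr p\<close> comes from \<open>powr_add_le\<close>, the
    other 2 from replacing \<open>\<bar>f n \<omega>\<bar> powr p\<close> by its upper bound
    \<open>\<bar>g \<omega>\<bar> powr p + b n \<omega>\<close>.\<close>
  define C where "C = 2 * 2 powr p"
  have ai: "integrable M (a n)" and bi: "integrable M (b n)" for n
    using di fi gi by (auto simp: a_def[abs_def] b_def[abs_def])
  have [measurable]: "a n \<in> borel_measurable M" for n using ai by auto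
  have a0: "0 \<le> a n \<omega>" for n \<omega> by (simp add: a_def)
  have b0: "0 \<le> b n \<omega>" for n \<omega> by (simp add: b_def)
  have C0: "0 \<le> C" by (simp add: C_def)
  have ab: "a n \<omega> \<le> min (a n \<omega>) (C * \<bar>g \<omega>\<bar> powr p) + C * b n \<omega>" for n \<omega>
  proof -
    have "a n \<omega> \<le> (\<bar>f n \<omega>\<bar> + \<bar>g \<omega>\<bar>) powr p" unfolding a_def using p by (intro powr_mono2) auto
    also have "\<dots> \<le> 2 powr p * (\<bar>f n \<omega>\<bar> powr p + \<bar>g \<omega>\<bar> powr p)" using p by (intro powr_add_le) auto
    also have "\<dots> \<le> 2 powr p * (2 * \<bar>g \<omega>\<bar> powr p + 2 * b n \<omega>)"
      unfolding b_def by (intro mult_left_mono) (smt (verit) powr_ge_zero, simp)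
    finally have "a n \<omega> \<le> C * \<bar>g \<omega>\<bar> powr p + C * b n \<omega>" by (simp add: C_def algebra_simps)
    moreover have "0 \<le> C * b n \<omega>" using C0 by (simp add: b_def)
    ultimately show ?thesis by (auto simp: min_def)
  qed
  have "AE \<omega> in M. (\<lambda>n. \<bar>f n \<omega>\<bar> powr p) \<longlonglongrightarrow> \<bar>g \<omega>\<bar> powr p"
    using ae by eventually_elim (use p in \<open>auto intro!: tendsto_powr' tendsto_rabs tendsto_const\<close>)
  moreover have "limsup (\<lambda>n. \<integral>\<^sup>+\<omega>. ennreal (norm (\<bar>f n \<omega>\<bar> powr p)) \<partial>M) \<le> (\<integral>\<^sup>+\<omega>. ennreal (norm (\<bar>g \<omega>\<bar> powr p)) \<partial>M)"
  proof -
    have "(\<lambda>n. \<integral>\<^sup>+\<omega>. ennreal (norm (\<bar>f n \<omega>\<bar> powr p)) \<partial>M) \<longlonglongrightarrow> (\<integral>\<^sup>+\<omega>. ennreal (norm (\<bar>g \<omega>\<bar> powr p)) \<partial>M)"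
      using tendsto_ennrealI[OF lim] fi gi by (simp add: nn_integral_eq_integral)
    then show ?thesis by (simp add: lim_imp_Limsup)
  qed
  ultimately have "(\<lambda>n. \<integral>\<^sup>+\<omega>. norm (\<bar>f n \<omega>\<bar> powr p - \<bar>g \<omega>\<bar> powr p) \<partial>M) \<longlonglongrightarrow> 0"
    using fi gi by (intro Scheffe_lemma1) auto
  then have "(\<lambda>n. \<integral>\<^sup>+\<omega>. ennreal (b n \<omega>) \<partial>M) \<longlonglongrightarrow> ennreal 0" by (simp add: b_def)
  also have "(\<lambda>n. \<integral>\<^sup>+\<omega>. ennreal (b n \<omega>) \<partial>M) = (\<lambda>n. ennreal (\<integral>\<omega>. b n \<omega> \<partial>M))"
    using bi b0 by (intro ext nn_integral_eq_integral) auto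
  finally have blim: "(\<lambda>n. \<integral>\<omega>. b n \<omega> \<partial>M) \<longlonglongrightarrow> 0"
    by (subst (asm) tendsto_ennreal_iff) (auto simp: b0)
  have mlim: "(\<lambda>n. \<integral>\<omega>. min (a n \<omega>) (C * \<bar>g \<omega>\<bar> powr p) \<partial>M) \<longlonglongrightarrow> (\<integral>\<omega>. 0 \<partial>M)"
  proof (rule integral_dominated_convergence)
    show "integrable M (\<lambda>\<omega>. C * \<bar>g \<omega>\<bar> powr p)" using gi by simp
    show "AE \<omega> in M. (\<lambda>n. min (a n \<omega>) (C * \<bar>g \<omega>\<bar> powr p)) \<longlonglongrightarrow> 0"
      using ae
    proof eventually_elim
      case (elim \<omega>)
      have "(\<lambda>n. a n \<omega>) \<longlonglongrightarrow> 0"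
        unfolding a_def using elim p by (intro tendsto_zero_powrI[of _ _ "\<lambda>_. p" p]) (auto intro: tendsto_rabs_zero LIM_zero)
      then have "(\<lambda>n. min (a n \<omega>) (C * \<bar>g \<omega>\<bar> powr p)) \<longlonglongrightarrow> min 0 (C * \<bar>g \<omega>\<bar> powr p)"
        by (intro tendsto_min tendsto_const)
      then show ?case using C0 by simp
    qed
  qed (use a0 C0 in \<open>auto simp: abs_of_nonneg\<close>)
  have mi: "integrable M (\<lambda>\<omega>. min (a n \<omega>) (C * \<bar>g \<omega>\<bar> powr p))" for n using ai gi by auto
  have up: "(\<integral>\<omega>. a n \<omega> \<partial>M) \<le> (\<integral>\<omega>. min (a n \<omega>) (C * \<bar>g \<omega>\<bar> powr p) \<partial>M) + C * (\<integral>\<omega>. b n \<omega> \<partial>M)" for n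
  proof -
    have "(\<integral>\<omega>. a n \<omega> \<partial>M) \<le> (\<integral>\<omega>. min (a n \<omega>) (C * \<bar>g \<omega>\<bar> powr p) + C * b n \<omega> \<partial>M)"
      using ai bi mi ab by (intro integral_mono) auto
    then show ?thesis using mi bi by simp
  qed
  have "(\<lambda>n. (\<integral>\<omega>. min (a n \<omega>) (C * \<bar>g \<omega>\<bar> powr p) \<partial>M) + C * (\<integral>\<omega>. b n \<omega> \<partial>M)) \<longlonglongrightarrow> 0"
    using tendsto_add[OF mlim tendsto_mult_left[OF blim, of C]] by simp
  from tendsto_sandwich[OF _ _ tendsto_const this] have "(\<lambda>n. \<integral>\<omega>. a n \<omega> \<partial>M) \<longlonglongrightarrow> 0"
    using up by (simp add: integral_nonneg a0)
  then show ?thesis by (simp add: a_def)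
qed

text \<open>The dominating function is the sum of the series. Formed in the extended reals it has
  finite integral, hence is finite almost everywhere. As \<open>enn2real\<close> sends infinity to
  0, the bound is asserted off the null set where the sum is infinite.\<close>

lemma AE_dominated_by_summable:
  fixes f :: "nat \<Rightarrow> 'a \<Rightarrow> real"
  assumes int: "\<And>k. integrable M (f k)" and nn: "\<And>k \<omega>. 0 \<le> f k \<omega>"
    and sm: "summable (\<lambda>k. \<integral>\<omega>. f k \<omega> \<partial>M)"
  obtains \<eta> where "integrable M \<eta>" "\<And>\<omega>. 0 \<le> \<eta> \<omega>" "\<And>k. AE \<omega> in M. f k \<omega> \<le> \<eta> \<omega>"
proof -
  have [measurable]: "\<And>k. f k \<in> borel_measurable M" using int by auto
  define S where "S \<omega> = (\<Sum>k. ennreal (f k \<omega>))" for \<omega>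
  have [measurable]: "S \<in> borel_measurable M" unfolding S_def by measurable
  have fin: "(\<integral>\<^sup>+\<omega>. S \<omega> \<partial>M) < \<infinity>"
  proof -
    have "(\<integral>\<^sup>+\<omega>. S \<omega> \<partial>M) = (\<Sum>k. \<integral>\<^sup>+\<omega>. ennreal (f k \<omega>) \<partial>M)"
      unfolding S_def by (rule nn_integral_suminf) auto
    also have "\<dots> = (\<Sum>k. ennreal (\<integral>\<omega>. f k \<omega> \<partial>M))"
      using int nn by (intro suminf_cong nn_integral_eq_integral) auto
    also have "\<dots> = ennreal (\<Sum>k. \<integral>\<omega>. f k \<omega> \<partial>M)"
      using nn sm by (intro suminf_ennreal2) auto
    finally show ?thesis by simp
  qed
  have ae: "AE \<omega> in M. S \<omega> \<noteq> \<infinity>" using fin by (intro nn_integral_PInf_AE) auto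
  show ?thesis
  proof
    show "integrable M (\<lambda>\<omega>. enn2real (S \<omega>))"
    proof (rule integrableI_bounded)
      have "(\<integral>\<^sup>+\<omega>. ennreal (norm (enn2real (S \<omega>))) \<partial>M) \<le> (\<integral>\<^sup>+\<omega>. S \<omega> \<partial>M)"
        by (intro nn_integral_mono) (simp add: ennreal_enn2real_if)
      then show "(\<integral>\<^sup>+\<omega>. ennreal (norm (enn2real (S \<omega>))) \<partial>M) < \<infinity>" using fin by simp
    qed simp
    show "AE \<omega> in M. f k \<omega> \<le> enn2real (S \<omega>)" for k
      using ae
    proof eventually_elim
      case (elim \<omega>)
      have "ennreal (f k \<omega>) \<le> S \<omega>" unfolding S_def using sum_le_suminf[of "\<lambda>k. ennreal (f k \<omega>)" "{k}"] by auto
      then show ?case using elim nn[of k \<omega>]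
        by (metis enn2real_ennreal enn2real_mono infinity_ennreal_def top.not_eq_extremum)
    qed
  qed auto
qed

text \<open>Convexity is used on two segments ending at \<open>\<xi> + \<eta>\<close>:
  \<open>\<xi>'\<close> is at most a point of the segment from \<open>\<xi>\<close>, and
  \<open>\<xi>\<close> is at most a point of the segment from \<open>\<xi>'\<close>.\<close>

lemma convex_risk_measure_perturbation:
  assumes crm: "convex_risk_measure M p \<rho>" and p: "0 \<le> p"
    and \<xi>: "\<xi> \<in> Lp_space M p" and \<xi>': "\<xi>' \<in> Lp_space M p" and \<eta>: "\<eta> \<in> Lp_space M p"
    and l: "0 < l" "l \<le> 1"
    and dom: "AE \<omega> in M. \<bar>\<xi>' \<omega> - \<xi> \<omega>\<bar> \<le> l * \<eta> \<omega>"
  shows "\<bar>\<rho> \<xi>' - \<rho> \<xi>\<bar> \<le> l * \<bar>\<rho> (\<lambda>\<omega>. \<xi> \<omega> + \<eta> \<omega>) - \<rho> \<xi>\<bar>"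
proof -
  note mono = crm[unfolded convex_risk_measure_def, THEN conjunct1, rule_format]
  note conv = crm[unfolded convex_risk_measure_def, THEN conjunct2, THEN conjunct2, rule_format]
  let ?r = "\<rho> (\<lambda>\<omega>. \<xi> \<omega> + \<eta> \<omega>)"
  note Lp = \<xi> \<xi>' \<eta> Lp_space_add[OF _ _ p] Lp_space_diff[OF _ _ p] Lp_space_cmult
  have "\<rho> \<xi>' \<le> \<rho> (\<lambda>\<omega>. l * (\<xi> \<omega> + \<eta> \<omega>) + (1 - l) * \<xi> \<omega>)"
    using dom by (intro mono Lp) (auto simp: algebra_simps elim!: eventually_mono)
  also have "\<dots> \<le> l * ?r + (1 - l) * \<rho> \<xi>"
    using l by (intro conv Lp) auto
  finally have 1: "\<rho> \<xi>' - \<rho> \<xi> \<le> l * (?r - \<rho> \<xi>)" by (simp add: algebra_simps)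
  \<comment> \<open>This weight satisfies \<open>l * (1 - t) = t\<close>: the deficit
    \<open>l * \<eta>\<close> that \<open>\<xi>'\<close> may have against \<open>\<xi>\<close> is
    compensated by the share \<open>t\<close> of \<open>\<eta>\<close>.\<close>
  define t where "t = l / (1 + l)"
  have t: "0 \<le> t" "t \<le> 1" "1 - t = 1 / (1 + l)" "l * (1 - t) = t" using l by (auto simp: t_def field_simps)
  have "\<rho> \<xi> \<le> \<rho> (\<lambda>\<omega>. t * (\<xi> \<omega> + \<eta> \<omega>) + (1 - t) * \<xi>' \<omega>)"
  proof (intro mono Lp)
    show "AE \<omega> in M. \<xi> \<omega> \<le> t * (\<xi> \<omega> + \<eta> \<omega>) + (1 - t) * \<xi>' \<omega>"
      using dom
    proof eventually_elim
      case (elim \<omega>)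
      have "(1 - t) * (\<xi> \<omega> - l * \<eta> \<omega>) \<le> (1 - t) * \<xi>' \<omega>"
        using elim t(2) by (intro mult_left_mono) simp_all
      moreover have "(1 - t) * (\<xi> \<omega> - l * \<eta> \<omega>) = (1 - t) * \<xi> \<omega> - t * \<eta> \<omega>"
        by (subst (2) t(4)[symmetric]) (simp add: algebra_simps)
      ultimately show ?case by (simp add: algebra_simps)
    qed
  qed
  also have "\<dots> \<le> t * ?r + (1 - t) * \<rho> \<xi>'" using t by (intro conv Lp) auto
  \<comment> \<open>Multiplication by \<open>1 + l\<close> turns the weights \<open>t\<close> and
    \<open>1 - t\<close> into \<open>l\<close> and 1.\<close>
  finally have "(1 + l) * \<rho> \<xi> \<le> (1 + l) * (t * ?r + (1 - t) * \<rho> \<xi>')" using l by (intro mult_left_mono) auto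
  also have "\<dots> = ((1 + l) * t) * ?r + ((1 + l) * (1 - t)) * \<rho> \<xi>'" by (simp only: distrib_left mult.assoc)
  also have "(1 + l) * t = l" using l by (simp add: t_def)
  also have "(1 + l) * (1 - t) = 1" using l t(3) by simp
  finally have 2: "\<rho> \<xi> - \<rho> \<xi>' \<le> l * (?r - \<rho> \<xi>)" by (simp add: algebra_simps)
  have "l * (?r - \<rho> \<xi>) \<le> l * \<bar>?r - \<rho> \<xi>\<bar>" using l by (intro mult_left_mono) auto
  with 1 2 show ?thesis by linarith
qed

text \<open>If the values stayed away from \<open>\<rho> \<xi>\<close> for infinitely many indices,
  terms converging arbitrarily fast could be picked among these. A common dominating function in
  \<open>L\<^sup>p\<close> would then force their values to converge after all.\<close>

lemma convex_risk_measure_continuous: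
  assumes crm: "convex_risk_measure M p \<rho>" and p: "0 < p"
    and \<xi>: "\<xi> \<in> Lp_space M p" and \<xi>n: "\<And>n. \<xi>n n \<in> Lp_space M p"
    and lim: "(\<lambda>n. \<integral>\<omega>. \<bar>\<xi>n n \<omega> - \<xi> \<omega>\<bar> powr p \<partial>M) \<longlonglongrightarrow> 0"
  shows "(\<lambda>n. \<rho> (\<xi>n n)) \<longlonglongrightarrow> \<rho> \<xi>"
proof (rule ccontr)
  assume "\<not> ?thesis"
  then obtain e where e: "e > 0" and "\<not> (\<forall>\<^sub>F n in sequentially. dist (\<rho> (\<xi>n n)) (\<rho> \<xi>) < e)"
    by (auto simp: tendsto_iff)
  then have bad: "\<exists>n\<ge>N. \<bar>\<rho> (\<xi>n n) - \<rho> \<xi>\<bar> \<ge> e" for N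
    by (auto simp: eventually_sequentially dist_real_def not_less)
  \<comment> \<open>Scaling by \<open>2 ^ k\<close> multiplies the \<open>p\<close>-th moment by
    \<open>(2 powr p) ^ k\<close>. The exponent \<open>p + 1\<close> in the rate leaves the summable
    bound \<open>(1 / 2) ^ k\<close>. The indices \<open>n k\<close> chosen below need not
    increase.\<close>
  have "\<exists>n. \<bar>\<rho> (\<xi>n n) - \<rho> \<xi>\<bar> \<ge> e \<and> (\<integral>\<omega>. \<bar>\<xi>n n \<omega> - \<xi> \<omega>\<bar> powr p \<partial>M) < (1 / 2 powr (p + 1)) ^ k" for k
  proof -
    have "\<forall>\<^sub>F n in sequentially. (\<integral>\<omega>. \<bar>\<xi>n n \<omega> - \<xi> \<omega>\<bar> powr p \<partial>M) < (1 / 2 powr (p + 1)) ^ k"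
      using order_tendstoD(2)[OF lim] by simp
    then show ?thesis using bad by (auto simp: eventually_sequentially)
  qed
  then obtain n where n: "\<And>k. \<bar>\<rho> (\<xi>n (n k)) - \<rho> \<xi>\<bar> \<ge> e"
    "\<And>k. (\<integral>\<omega>. \<bar>\<xi>n (n k) \<omega> - \<xi> \<omega>\<bar> powr p \<partial>M) < (1 / 2 powr (p + 1)) ^ k" by metis
  define f where "f k \<omega> = (2 ^ k * \<bar>\<xi>n (n k) \<omega> - \<xi> \<omega>\<bar>) powr p" for k \<omega>
  have f_eq: "f k = (\<lambda>\<omega>. (2 powr p) ^ k * \<bar>\<xi>n (n k) \<omega> - \<xi> \<omega>\<bar> powr p)" for k
  proof -
    have "(2 ^ k :: real) powr p = (2 powr real k) powr p" by (simp only: powr_realpow zero_less_numeral)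
    also have "\<dots> = (2 powr p) powr real k" by (simp only: powr_powr mult.commute)
    also have "\<dots> = (2 powr p) ^ k" by (intro powr_realpow) simp
    finally show ?thesis by (simp add: f_def[abs_def] powr_mult)
  qed
  have intd: "integrable M (\<lambda>\<omega>. \<bar>\<xi>n (n k) \<omega> - \<xi> \<omega>\<bar> powr p)" for k
    using Lp_space_diff[OF \<xi>n[of "n k"] \<xi>] p by (simp add: Lp_space_def)
  have int: "integrable M (f k)" for k
    unfolding f_eq using intd by simp
  have nn: "0 \<le> f k \<omega>" for k \<omega> by (simp add: f_def)
  have "(\<integral>\<omega>. f k \<omega> \<partial>M) \<le> (1 / 2) ^ k" for k
  proof -
    have "(\<integral>\<omega>. f k \<omega> \<partial>M) = (2 powr p) ^ k * (\<integral>\<omega>. \<bar>\<xi>n (n k) \<omega> - \<xi> \<omega>\<bar> powr p \<partial>M)"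
      by (simp add: f_eq)
    also have "\<dots> \<le> (2 powr p) ^ k * (1 / 2 powr (p + 1)) ^ k"
      using n(2)[of k] by (intro mult_left_mono less_imp_le) auto
    also have "\<dots> = (1 / 2) ^ k" by (simp add: power_mult_distrib[symmetric] powr_add)
    finally show ?thesis .
  qed
  then have "summable (\<lambda>k. \<integral>\<omega>. f k \<omega> \<partial>M)"
    by (intro summable_comparison_test'[OF summable_geometric[of "1/2"], where N=0])
      (simp_all add: integral_nonneg nn)
  then obtain h where h: "integrable M h" "\<And>\<omega>. 0 \<le> h \<omega>" "\<And>k. AE \<omega> in M. f k \<omega> \<le> h \<omega>"
    using AE_dominated_by_summable[of M f, OF int nn] by metis
  \<comment> \<open>The \<open>p\<close>-th root brings the integrable bound \<open>h\<close> into
    \<open>L\<^sup>p\<close>, where it dominates every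
    \<open>2 ^ k * \<bar>\<xi>n (n k) \<omega> - \<xi> \<omega>\<bar>\<close> almost surely.\<close>
  define \<eta> where "\<eta> \<omega> = h \<omega> powr (1 / p)" for \<omega>
  have \<eta>: "\<eta> \<in> Lp_space M p"
  proof -
    have "\<eta> \<in> borel_measurable M" unfolding \<eta>_def using h(1) by measurable
    moreover have "\<bar>\<eta> \<omega>\<bar> powr p = h \<omega>" for \<omega> using h(2)[of \<omega>] p by (simp add: \<eta>_def powr_powr)
    ultimately show ?thesis using h(1) by (simp add: Lp_space_def)
  qed
  have dom: "AE \<omega> in M. \<bar>\<xi>n (n k) \<omega> - \<xi> \<omega>\<bar> \<le> (1 / 2) ^ k * \<eta> \<omega>" for k
    using h(3)[of k]
  proof eventually_elim
    case (elim \<omega>)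
    then have "f k \<omega> powr (1 / p) \<le> \<eta> \<omega>" unfolding \<eta>_def using p nn by (intro powr_mono2) auto
    then have "2 ^ k * \<bar>\<xi>n (n k) \<omega> - \<xi> \<omega>\<bar> \<le> \<eta> \<omega>" using p by (simp add: f_def powr_powr)
    then have "(1 / 2) ^ k * (2 ^ k * \<bar>\<xi>n (n k) \<omega> - \<xi> \<omega>\<bar>) \<le> (1 / 2) ^ k * \<eta> \<omega>"
      by (intro mult_left_mono) simp_all
    then show ?case by (simp add: power_one_over)
  qed
  let ?c = "\<bar>\<rho> (\<lambda>\<omega>. \<xi> \<omega> + \<eta> \<omega>) - \<rho> \<xi>\<bar>"
  \<comment> \<open>This is the perturbation bound with \<open>l = (1 / 2) ^ k\<close>. As
    \<open>?c\<close> does not depend on \<open>k\<close>, the right side tends to 0.\<close>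
  have le: "e \<le> (1 / 2) ^ k * ?c" for k
  proof -
    have "\<bar>\<rho> (\<xi>n (n k)) - \<rho> \<xi>\<bar> \<le> (1 / 2) ^ k * ?c"
      using p by (intro convex_risk_measure_perturbation[OF crm _ \<xi> \<xi>n \<eta> _ _ dom]) (simp_all add: power_le_one)
    then show ?thesis using n(1)[of k] by (rule order_trans[rotated])
  qed
  have "(\<lambda>k. (1 / 2) ^ k * ?c) \<longlonglongrightarrow> 0"
    by (intro tendsto_mult_left_zero LIMSEQ_power_zero) auto
  then have "e \<le> 0" by (rule LIMSEQ_le_const) (simp add: le)
  then show False using e by simp
qed

text \<open>The growth bound \<open>1 + \<bar>s\<bar> powr p\<close> admits the two kinds of test
  function that matter: bounded ones give weak convergence of the laws, the \<open>p\<close>-th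
  power gives convergence of the moments. Coupling by quantiles then reduces the claim to continuity
  of \<open>\<rho>\<close>.\<close>

lemma risk_under_tendsto:
  assumes M: "prob_space M" "nonatomic M" and crm: "convex_risk_measure M p \<rho>" and p: "p \<ge> 1"
    and P: "\<And>n. prob_space (P n)" and Q: "prob_space Q"
    and \<phi>n: "\<And>n. \<phi>n n \<in> borel_measurable (P n)" and \<phi>: "\<phi> \<in> borel_measurable Q"
    and intn: "\<And>n. integrable (P n) (\<lambda>y. \<bar>\<phi>n n y\<bar> powr p)" and int: "integrable Q (\<lambda>y. \<bar>\<phi> y\<bar> powr p)"
    and conv: "\<And>f. continuous_on UNIV f \<Longrightarrow> (\<And>s. \<bar>f s\<bar> \<le> 1 + \<bar>s\<bar> powr p) \<Longrightarrow>
      (\<lambda>n. \<integral>y. f (\<phi>n n y) \<partial>P n) \<longlonglongrightarrow> (\<integral>y. f (\<phi> y) \<partial>Q)"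
  shows "(\<lambda>n. risk_under M \<rho> (P n) (\<phi>n n)) \<longlonglongrightarrow> risk_under M \<rho> Q \<phi>"
proof -
  interpret prob_space M by fact
  \<comment> \<open>This is the very choice made in \<open>induced_functional\<close>, so the risks
    are the values of \<open>\<rho>\<close> at \<open>F n\<close> and \<open>F'\<close> below, all
    built on one variable.\<close>
  define U where "U = (SOME U. uniform01 M U)"
  have U: "uniform01 M U" unfolding U_def using uniform01_exists[OF M(2)] by (rule someI_ex)
  have [measurable]: "U \<in> borel_measurable M" using U by (simp add: uniform01_def)
  define \<mu> where "\<mu> n = distr (P n) borel (\<phi>n n)" for n
  define \<nu> where "\<nu> = distr Q borel \<phi>"
  have \<mu>: "real_distribution (\<mu> n)" for n
    unfolding \<mu>_def by (rule prob_space.real_distribution_distr[OF P \<phi>n])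
  have \<nu>: "real_distribution \<nu>"
    unfolding \<nu>_def by (rule prob_space.real_distribution_distr[OF Q \<phi>])
  have int_\<mu>: "(\<integral>s. f s \<partial>\<mu> n) = (\<integral>y. f (\<phi>n n y) \<partial>P n)" if "f \<in> borel_measurable borel" for f :: "real \<Rightarrow> real" and n
    unfolding \<mu>_def using that \<phi>n by (intro integral_distr) auto
  have int_\<nu>: "(\<integral>s. f s \<partial>\<nu>) = (\<integral>y. f (\<phi> y) \<partial>Q)" if "f \<in> borel_measurable borel" for f :: "real \<Rightarrow> real"
    unfolding \<nu>_def using that \<phi> by (intro integral_distr) auto
  have wc: "weak_conv_m \<mu> \<nu>"
  proof (rule integral_bdd_continuous_conv_imp_weak_conv[OF \<mu> \<nu>])
    fix f :: "real \<Rightarrow> real" assume f: "\<And>x. isCont f x" "\<And>x. \<bar>f x\<bar> \<le> 1"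
    have c: "continuous_on UNIV f" using f(1) by (simp add: continuous_at_imp_continuous_on)
    have "\<bar>f s\<bar> \<le> 1 + \<bar>s\<bar> powr p" for s using f(2)[of s] powr_ge_zero[of "\<bar>s\<bar>" p] by linarith
    from conv[OF c this] show "(\<lambda>n. integral\<^sup>L (\<mu> n) f) \<longlonglongrightarrow> integral\<^sup>L \<nu> f"
      using c by (simp add: int_\<mu> int_\<nu> borel_measurable_continuous_onI)
  qed
  have m: "(\<lambda>s::real. \<bar>s\<bar> powr p) \<in> borel_measurable borel" by measurable
  define F where "F n \<omega> = quantile (\<mu> n) (U \<omega>)" for n \<omega>
  define F' where "F' \<omega> = quantile \<nu> (U \<omega>)" for \<omega>
  have Fm [measurable]: "F n \<in> borel_measurable M" for n
    unfolding F_def using quantile_measurable[OF \<mu>] by measurable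
  have F'm [measurable]: "F' \<in> borel_measurable M"
    unfolding F'_def using quantile_measurable[OF \<nu>] by measurable
  have dF: "distr M borel (F n) = \<mu> n" for n
    unfolding F_def by (rule distr_quantile_uniform[OF U \<mu>])
  have dF': "distr M borel F' = \<nu>"
    unfolding F'_def by (rule distr_quantile_uniform[OF U \<nu>])
  have FL: "F n \<in> Lp_space M p" for n
  proof -
    have "integrable (\<mu> n) (\<lambda>s. \<bar>s\<bar> powr p)"
      unfolding \<mu>_def using intn \<phi>n m by (subst integrable_distr_eq) auto
    then have "integrable M (\<lambda>\<omega>. \<bar>F n \<omega>\<bar> powr p)"
      unfolding dF[symmetric] using Fm m by (subst (asm) integrable_distr_eq) auto
    then show ?thesis by (simp add: Lp_space_def Fm)
  qed
  have F'L: "F' \<in> Lp_space M p"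
  proof -
    have "integrable \<nu> (\<lambda>s. \<bar>s\<bar> powr p)"
      unfolding \<nu>_def using int \<phi> m by (subst integrable_distr_eq) auto
    then have "integrable M (\<lambda>\<omega>. \<bar>F' \<omega>\<bar> powr p)"
      unfolding dF'[symmetric] using F'm m by (subst (asm) integrable_distr_eq) auto
    then show ?thesis by (simp add: Lp_space_def F'm)
  qed
  have "(\<lambda>n. \<integral>y. \<bar>\<phi>n n y\<bar> powr p \<partial>P n) \<longlonglongrightarrow> (\<integral>y. \<bar>\<phi> y\<bar> powr p \<partial>Q)"
    using p by (intro conv continuous_on_powr' continuous_intros) auto
  moreover have "(\<integral>\<omega>. \<bar>F n \<omega>\<bar> powr p \<partial>M) = (\<integral>y. \<bar>\<phi>n n y\<bar> powr p \<partial>P n)" for n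
    using integral_distr[OF Fm m, of n] int_\<mu>[OF m, of n] by (simp add: dF)
  moreover have "(\<integral>\<omega>. \<bar>F' \<omega>\<bar> powr p \<partial>M) = (\<integral>y. \<bar>\<phi> y\<bar> powr p \<partial>Q)"
    using integral_distr[OF F'm m] int_\<nu>[OF m] by (simp add: dF')
  ultimately have mom: "(\<lambda>n. \<integral>\<omega>. \<bar>F n \<omega>\<bar> powr p \<partial>M) \<longlonglongrightarrow> (\<integral>\<omega>. \<bar>F' \<omega>\<bar> powr p \<partial>M)" by simp
  have "AE \<omega> in M. (\<lambda>n. F n \<omega>) \<longlonglongrightarrow> F' \<omega>"
    unfolding F_def F'_def by (rule AE_quantile_tendsto[OF \<mu> \<nu> wc U])
  from Lp_convergence[OF FL F'L _ this mom] p
  have "(\<lambda>n. \<integral>\<omega>. \<bar>F n \<omega> - F' \<omega>\<bar> powr p \<partial>M) \<longlonglongrightarrow> 0" by simp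
  then have "(\<lambda>n. \<rho> (F n)) \<longlonglongrightarrow> \<rho> F'"
    using p by (intro convex_risk_measure_continuous[OF crm _ F'L FL]) auto
  then show ?thesis
    by (simp add: risk_under_def induced_functional_def F_def[abs_def] F'_def[abs_def] U_def \<mu>_def \<nu>_def)
qed

section \<open>Integrals of varying functions under varying measures\<close>

text \<open>Although \<open>S\<close> need not be closed, only test functions on the whole space are available, so the
  integrands \<open>G n\<close> are bounded below by their truncated Lipschitz regularizations \<open>\<phi> k\<close>, which are
  defined everywhere.\<close>
lemma nn_integral_le_liminf_varying_measure:
  fixes G :: "nat \<Rightarrow> 'a::metric_space \<Rightarrow> real" and g :: "'a \<Rightarrow> real"
  assumes P: "\<And>n. prob_space (P n)" "\<And>n. sets (P n) = sets (restrict_space borel S)"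
    and Q: "prob_space Q" "sets Q = sets (restrict_space borel S)"
    and conv: "\<And>\<phi>. continuous_on UNIV \<phi> \<Longrightarrow> bounded (range \<phi>) \<Longrightarrow>
      (\<lambda>n. \<integral>y. \<phi> y \<partial>P n) \<longlonglongrightarrow> (\<integral>y. \<phi> y \<partial>Q :: real)"
    and nonneg: "\<And>n y. y \<in> S \<Longrightarrow> 0 \<le> G n y"
    and lsc: "\<And>y a. y \<in> S \<Longrightarrow> a < g y \<Longrightarrow> \<exists>\<delta>>0. \<exists>N. \<forall>n\<ge>N. \<forall>y'\<in>S. dist y y' < \<delta> \<longrightarrow> a \<le> G n y'"
  shows "(\<integral>\<^sup>+y. ennreal (g y) \<partial>Q) \<le> liminf (\<lambda>n. \<integral>\<^sup>+y. ennreal (G n y) \<partial>P n)"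
proof -
  have sp: "space (P n) = S" "space Q = S" for n
    using sets_eq_imp_space_eq[OF P(2)] sets_eq_imp_space_eq[OF Q(2)] by (auto simp: space_restrict_space)
  have S: "S \<noteq> {}" using prob_space.not_empty[OF Q(1)] sp by simp
  have meas: "\<phi> \<in> borel_measurable (P n)" "\<phi> \<in> borel_measurable Q" if "continuous_on UNIV \<phi>" for \<phi> :: "'a \<Rightarrow> real" and n
    unfolding measurable_cong_sets[OF P(2) refl] measurable_cong_sets[OF Q(2) refl]
    by (rule measurable_restrict_space1[OF borel_measurable_continuous_onI[OF that]])+
  \<comment> \<open>\<open>\<psi> k\<close> is an infimal convolution with the penalty
    \<open>k * dist\<close>, hence \<open>k\<close>-Lipschitz. Taking the infimum over all
    \<open>n \<ge> k\<close> as well gives \<open>\<phi> k \<le> G n\<close> on \<open>S\<close> for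
    each such \<open>n\<close>; the cut at \<open>k\<close> makes \<open>\<phi> k\<close>
    bounded.\<close>
  define F where "F k y = (\<lambda>(n, y'). G n y' + real k * dist y y')" for k y
  define I where "I k = {k..} \<times> S" for k :: nat
  define \<psi> where "\<psi> k y = (INF i\<in>I k. F k y i)" for k y
  define \<phi> where "\<phi> k y = min (real k) (\<psi> k y)" for k y
  have Ine: "I k \<noteq> {}" for k using S by (auto simp: I_def)
  have Fnn: "0 \<le> F k y i" if "i \<in> I k" for k y i
    using that nonneg by (auto simp: I_def F_def)
  have bdd: "bdd_below (F k y ` I k)" for k y using Fnn by (intro bdd_belowI[of _ 0]) auto
  have \<psi>_lower: "\<psi> k y \<le> F k y i" if "i \<in> I k" for k y i
    unfolding \<psi>_def by (rule cINF_lower[OF bdd that])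
  have \<psi>_greatest: "a \<le> \<psi> k y" if "\<And>i. i \<in> I k \<Longrightarrow> a \<le> F k y i" for a k y
    unfolding \<psi>_def by (rule cINF_greatest[OF Ine that])
  have \<psi>nn: "0 \<le> \<psi> k y" for k y using Fnn by (rule \<psi>_greatest)
  have \<psi>_lip: "\<psi> k y - real k * dist y z \<le> \<psi> k z" for k y z
  proof (rule \<psi>_greatest)
    fix i assume i: "i \<in> I k"
    have "real k * dist y (snd i) \<le> real k * (dist y z + dist z (snd i))"
      by (intro mult_left_mono dist_triangle) auto
    then have "F k y i \<le> F k z i + real k * dist y z" by (simp add: F_def split_beta algebra_simps)
    then show "\<psi> k y - real k * dist y z \<le> F k z i" using \<psi>_lower[OF i, of y] by linarith
  qed
  have "k-lipschitz_on UNIV (\<psi> k)" for k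
  proof (rule lipschitz_onI)
    show "dist (\<psi> k y) (\<psi> k z) \<le> real k * dist y z" for y z
      using \<psi>_lip[of k y z] \<psi>_lip[of k z y] by (simp add: dist_real_def dist_commute abs_le_iff)
  qed simp
  then have "continuous_on UNIV (\<psi> k)" for k by (rule lipschitz_on_continuous_on)
  then have \<phi>c: "continuous_on UNIV (\<phi> k)" for k unfolding \<phi>_def by (intro continuous_intros)
  have \<phi>nn: "0 \<le> \<phi> k y" and \<phi>k: "\<phi> k y \<le> real k" for k y using \<psi>nn by (auto simp: \<phi>_def)
  have \<phi>b: "bounded (range (\<phi> k))" for k
    unfolding bounded_iff using \<phi>nn \<phi>k by (intro exI[of _ "real k"]) (auto simp: abs_of_nonneg)
  have \<phi>G: "\<phi> k y \<le> G n y" if "y \<in> S" "k \<le> n" for k n y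
    using \<psi>_lower[of "(n, y)" k y] that by (auto simp: \<phi>_def I_def F_def)
  \<comment> \<open>Near \<open>y\<close> and for large \<open>n\<close>, \<open>lsc\<close> bounds
    \<open>G n\<close> below by \<open>a\<close>. At distance at least \<open>\<delta>\<close> the
    penalty alone reaches \<open>a\<close> once \<open>k \<ge> a / \<delta>\<close>, and the cut
    does no harm once \<open>k \<ge> a\<close>.\<close>
  have pointwise: "ennreal (g y) \<le> liminf (\<lambda>k. ennreal (\<phi> k y))" if y: "y \<in> S" for y
    unfolding le_Liminf_iff
  proof safe
    fix b :: ennreal assume "b < ennreal (g y)"
    then obtain b' where b': "b = ennreal b'" "0 \<le> b'" "b' < g y"
      by (cases b) (auto simp: ennreal_less_iff)
    then obtain a where a: "b' < a" "a < g y" using dense by blast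
    obtain \<delta> N where \<delta>: "\<delta> > 0" and N: "\<And>n y'. n \<ge> N \<Longrightarrow> y' \<in> S \<Longrightarrow> dist y y' < \<delta> \<Longrightarrow> a \<le> G n y'"
      using lsc[OF y a(2)] by blast
    obtain K where K: "a / \<delta> \<le> real K" using real_arch_simple by blast
    obtain L where L: "a \<le> real L" using real_arch_simple by blast
    have "b' < \<phi> k y" if k: "k \<ge> max N (max K L)" for k
    proof -
      have "a \<le> \<psi> k y"
      proof (rule \<psi>_greatest)
        fix i assume "i \<in> I k"
        then obtain n y' where i: "i = (n, y')" "k \<le> n" "y' \<in> S" by (auto simp: I_def)
        show "a \<le> F k y i"
        proof (cases "dist y y' < \<delta>")
          case True
          then have "a \<le> G n y'" using N i k by auto
          then show ?thesis using i by (simp add: F_def add_increasing2)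
        next
          case False
          have "a \<le> real K * \<delta>" using K \<delta> by (simp add: field_simps)
          also have "\<dots> \<le> real k * dist y y'" using False k \<delta> by (intro mult_mono) auto
          finally show ?thesis using i nonneg[of y' n] by (simp add: F_def)
        qed
      qed
      moreover have "a \<le> real k" using L k by linarith
      ultimately show ?thesis using a by (simp add: \<phi>_def)
    qed
    then have "b < ennreal (\<phi> k y)" if "k \<ge> max N (max K L)" for k
      using that b' by (simp add: ennreal_less_iff)
    then show "\<forall>\<^sub>F k in sequentially. b < ennreal (\<phi> k y)"
      unfolding eventually_sequentially by blast
  qed
  \<comment> \<open>For fixed \<open>k\<close> the bounded continuous \<open>\<phi> k\<close> allows
    passing to the limit in \<open>n\<close>. Fatou's lemma under \<open>Q\<close> then deals with
    \<open>k\<close>.\<close>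
  have step: "(\<integral>\<^sup>+y. ennreal (\<phi> k y) \<partial>Q) \<le> liminf (\<lambda>n. \<integral>\<^sup>+y. ennreal (G n y) \<partial>P n)" for k
  proof -
    have "integrable (P n) (\<phi> k)" for n
      using \<phi>nn \<phi>k by (intro finite_measure.integrable_const_bound[OF prob_space.finite_measure[OF P(1)], of _ "real k"] meas \<phi>c)
        (auto simp: abs_of_nonneg)
    moreover have "integrable Q (\<phi> k)"
      using \<phi>nn \<phi>k by (intro finite_measure.integrable_const_bound[OF prob_space.finite_measure[OF Q(1)], of _ "real k"] meas \<phi>c)
        (auto simp: abs_of_nonneg)
    ultimately have "(\<lambda>n. \<integral>\<^sup>+y. ennreal (\<phi> k y) \<partial>P n) \<longlonglongrightarrow> (\<integral>\<^sup>+y. ennreal (\<phi> k y) \<partial>Q)"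
      using tendsto_ennrealI[OF conv[OF \<phi>c \<phi>b, of k]] \<phi>nn by (simp add: nn_integral_eq_integral)
    then have "(\<integral>\<^sup>+y. ennreal (\<phi> k y) \<partial>Q) = liminf (\<lambda>n. \<integral>\<^sup>+y. ennreal (\<phi> k y) \<partial>P n)"
      by (simp add: lim_imp_Liminf)
    also have "\<dots> \<le> liminf (\<lambda>n. \<integral>\<^sup>+y. ennreal (G n y) \<partial>P n)"
    proof (rule Liminf_mono)
      show "\<forall>\<^sub>F n in sequentially. (\<integral>\<^sup>+y. ennreal (\<phi> k y) \<partial>P n) \<le> (\<integral>\<^sup>+y. ennreal (G n y) \<partial>P n)"
        using eventually_ge_at_top[of k]
        by eventually_elim (auto intro!: nn_integral_mono ennreal_leI \<phi>G simp: sp)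
    qed
    finally show ?thesis .
  qed
  have "(\<integral>\<^sup>+y. ennreal (g y) \<partial>Q) \<le> (\<integral>\<^sup>+y. liminf (\<lambda>k. ennreal (\<phi> k y)) \<partial>Q)"
    using pointwise by (intro nn_integral_mono) (auto simp: sp)
  also have "\<dots> \<le> liminf (\<lambda>k. \<integral>\<^sup>+y. ennreal (\<phi> k y) \<partial>Q)"
    using meas(2)[OF \<phi>c] by (intro nn_integral_liminf) measurable
  also have "\<dots> \<le> liminf (\<lambda>k::nat. liminf (\<lambda>n. \<integral>\<^sup>+y. ennreal (G n y) \<partial>P n))"
    using step by (intro Liminf_mono) auto
  also have "\<dots> = liminf (\<lambda>n. \<integral>\<^sup>+y. ennreal (G n y) \<partial>P n)"
    by (simp add: Liminf_const)
  finally show ?thesis .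
qed

text \<open>A generalized dominated convergence theorem: \<open>w + H n\<close> and
  \<open>w - H n\<close> are nonnegative on \<open>S\<close>, so the liminf inequality applies to
  both, and convergence of the integrals of \<open>w\<close> lets \<open>w\<close> be subtracted
  again. Condition \<open>Hh\<close> is continuous convergence of \<open>H n\<close> to
  \<open>h\<close>.\<close>

lemma integral_tendsto_varying_measure:
  fixes H :: "nat \<Rightarrow> 'a::metric_space \<Rightarrow> real" and h w :: "'a \<Rightarrow> real"
  assumes P: "\<And>n. prob_space (P n)" "\<And>n. sets (P n) = sets (restrict_space borel S)"
    and Q: "prob_space Q" "sets Q = sets (restrict_space borel S)"
    and conv: "\<And>\<phi>. continuous_on UNIV \<phi> \<Longrightarrow> bounded (range \<phi>) \<Longrightarrow>
      (\<lambda>n. \<integral>y. \<phi> y \<partial>P n) \<longlonglongrightarrow> (\<integral>y. \<phi> y \<partial>Q :: real)"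
    and w: "continuous_on S w" "\<And>n. integrable (P n) w" "integrable Q w"
      "(\<lambda>n. \<integral>y. w y \<partial>P n) \<longlonglongrightarrow> (\<integral>y. w y \<partial>Q)"
    and Hm: "\<And>n. H n \<in> borel_measurable (restrict_space borel S)" "h \<in> borel_measurable (restrict_space borel S)"
    and Hw: "\<And>n y. y \<in> S \<Longrightarrow> \<bar>H n y\<bar> \<le> w y"
    and Hh: "\<And>y e. y \<in> S \<Longrightarrow> e > 0 \<Longrightarrow> \<exists>\<delta>>0. \<exists>N. \<forall>n\<ge>N. \<forall>y'\<in>S. dist y y' < \<delta> \<longrightarrow> \<bar>H n y' - h y\<bar> < e"
  shows "(\<lambda>n. \<integral>y. H n y \<partial>P n) \<longlonglongrightarrow> (\<integral>y. h y \<partial>Q)"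
proof -
  have sp: "space (P n) = S" "space Q = S" for n
    using sets_eq_imp_space_eq[OF P(2)] sets_eq_imp_space_eq[OF Q(2)] by (auto simp: space_restrict_space)
  \<comment> \<open>Taking \<open>y' = y\<close> in \<open>Hh\<close> gives pointwise convergence,
    so the bound by \<open>w\<close> passes to the limit.\<close>
  have hw: "\<bar>h y\<bar> \<le> w y" if y: "y \<in> S" for y
  proof (rule field_le_epsilon)
    fix e :: real assume "0 < e"
    then obtain N where "\<forall>n\<ge>N. \<bar>H n y - h y\<bar> < e" using Hh[OF y] y by (metis dist_self)
    then have "\<bar>H N y - h y\<bar> < e" by simp
    then show "\<bar>h y\<bar> \<le> w y + e" using Hw[OF y, of N] by linarith
  qed
  \<comment> \<open>Stated for arbitrary \<open>H\<close> and \<open>h\<close>, because the upper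
    bound is the same claim for the negated functions.\<close>
  have lower: "\<forall>\<^sub>F n in sequentially. a < (\<integral>y. H n y \<partial>P n)"
    if Hm: "\<And>n. H n \<in> borel_measurable (restrict_space borel S)" "h \<in> borel_measurable (restrict_space borel S)"
    and Hw: "\<And>n y. y \<in> S \<Longrightarrow> \<bar>H n y\<bar> \<le> w y" and hw: "\<And>y. y \<in> S \<Longrightarrow> \<bar>h y\<bar> \<le> w y"
    and Hh: "\<And>y e. y \<in> S \<Longrightarrow> e > 0 \<Longrightarrow> \<exists>\<delta>>0. \<exists>N. \<forall>n\<ge>N. \<forall>y'\<in>S. dist y y' < \<delta> \<longrightarrow> \<bar>H n y' - h y\<bar> < e"
    and a: "a < (\<integral>y. h y \<partial>Q)"
    for H :: "nat \<Rightarrow> 'a \<Rightarrow> real" and h a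
  proof -
    have HP: "H n \<in> borel_measurable (P n)" for n using Hm(1) measurable_cong_sets[OF P(2) refl] by blast
    have hQ: "h \<in> borel_measurable Q" using Hm(2) measurable_cong_sets[OF Q(2) refl] by blast
    have HI: "integrable (P n) (H n)" for n
      by (rule Bochner_Integration.integrable_bound[OF w(2) HP]) (auto simp: sp intro!: AE_I2 order_trans[OF Hw])
    have hI: "integrable Q h"
      by (rule Bochner_Integration.integrable_bound[OF w(3) hQ]) (auto simp: sp intro!: AE_I2 order_trans[OF hw])
    have Hnn: "0 \<le> w y + H n y" if "y \<in> S" for n y using Hw[OF that, of n] by linarith
    have hnn: "0 \<le> w y + h y" if "y \<in> S" for y using hw[OF that] by linarith
    have lim: "(\<integral>\<^sup>+y. ennreal (w y + h y) \<partial>Q) \<le> liminf (\<lambda>n. \<integral>\<^sup>+y. ennreal (w y + H n y) \<partial>P n)"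
    proof (rule nn_integral_le_liminf_varying_measure[OF P Q conv Hnn])
      fix y b assume y: "y \<in> S" and "b < w y + h y"
      \<comment> \<open>Half the gap is allowed for the error of \<open>H n\<close>, the other half
        for that of \<open>w\<close>.\<close>
      define e where "e = (w y + h y - b) / 2"
      have e: "e > 0" using \<open>b < w y + h y\<close> by (simp add: e_def)
      obtain \<delta> N where \<delta>: "\<delta> > 0" "\<And>n y'. n \<ge> N \<Longrightarrow> y' \<in> S \<Longrightarrow> dist y y' < \<delta> \<Longrightarrow> \<bar>H n y' - h y\<bar> < e"
        using Hh[OF y e] by blast
      obtain \<delta>' where \<delta>': "\<delta>' > 0" "\<And>y'. y' \<in> S \<Longrightarrow> dist y' y < \<delta>' \<Longrightarrow> dist (w y') (w y) < e"
        using w(1) y e unfolding continuous_on_iff by metis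
      show "\<exists>\<delta>>0. \<exists>N. \<forall>n\<ge>N. \<forall>y'\<in>S. dist y y' < \<delta> \<longrightarrow> b \<le> w y' + H n y'"
      proof (intro exI[of _ "min \<delta> \<delta>'"] conjI exI[of _ N] allI ballI impI)
        fix n y' assume *: "N \<le> n" "y' \<in> S" "dist y y' < min \<delta> \<delta>'"
        then have "\<bar>H n y' - h y\<bar> < e" "\<bar>w y' - w y\<bar> < e"
          using \<delta>(2)[of n y'] \<delta>'(2)[of y'] by (auto simp: dist_real_def dist_commute)
        moreover have "2 * e = w y + h y - b" by (simp add: e_def)
        ultimately show "b \<le> w y' + H n y'" by linarith
      qed (use \<delta> \<delta>' in auto)
    qed
    \<comment> \<open>The room between \<open>a\<close> and \<open>a'\<close> later absorbs the
      difference between the integrals of \<open>w\<close> under \<open>P n\<close> and under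
      \<open>Q\<close>.\<close>
    obtain a' where a': "a < a'" "a' < (\<integral>y. h y \<partial>Q)" using a dense by blast
    let ?W = "\<integral>y. w y \<partial>Q"
    have eqQ: "(\<integral>\<^sup>+y. ennreal (w y + h y) \<partial>Q) = ennreal (?W + (\<integral>y. h y \<partial>Q))"
      using w(3) hI hnn by (subst nn_integral_eq_integral) (auto simp: sp intro!: AE_I2)
    have eqP: "(\<integral>\<^sup>+y. ennreal (w y + H n y) \<partial>P n) = ennreal ((\<integral>y. w y \<partial>P n) + (\<integral>y. H n y \<partial>P n))" for n
      using w(2) HI Hnn by (subst nn_integral_eq_integral) (auto simp: sp intro!: AE_I2)
    have nnP: "0 \<le> (\<integral>y. w y \<partial>P n) + (\<integral>y. H n y \<partial>P n)" for n
    proof -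
      have "0 \<le> (\<integral>y. w y + H n y \<partial>P n)" by (intro Bochner_Integration.integral_nonneg) (simp add: sp Hnn)
      then show ?thesis using w(2) HI by simp
    qed
    \<comment> \<open>Since \<open>ennreal\<close> sends negative reals to 0, a negative bound is
      treated separately; there nonnegativity of the integrals suffices.\<close>
    have "\<forall>\<^sub>F n in sequentially. ?W + a' \<le> (\<integral>y. w y \<partial>P n) + (\<integral>y. H n y \<partial>P n)"
    proof (cases "0 \<le> ?W + a'")
      case True
      then have "ennreal (?W + a') < (\<integral>\<^sup>+y. ennreal (w y + h y) \<partial>Q)"
        unfolding eqQ using a' by (simp add: ennreal_less_iff)
      with lim have "ennreal (?W + a') < liminf (\<lambda>n. \<integral>\<^sup>+y. ennreal (w y + H n y) \<partial>P n)" by simp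
      from less_LiminfD[OF this] show ?thesis
        by eventually_elim (use True in \<open>simp add: eqP ennreal_less_iff\<close>)
    next
      case False
      then have "?W + a' \<le> (\<integral>y. w y \<partial>P n) + (\<integral>y. H n y \<partial>P n)" for n using nnP[of n] by linarith
      then show ?thesis by simp
    qed
    moreover have "\<forall>\<^sub>F n in sequentially. (\<integral>y. w y \<partial>P n) < ?W + (a' - a)"
      using a' by (intro order_tendstoD(2)[OF w(4)]) simp
    ultimately show ?thesis by eventually_elim linarith
  qed
  show ?thesis
  proof (rule order_tendstoI)
    fix a assume "a < (\<integral>y. h y \<partial>Q)"
    then show "\<forall>\<^sub>F n in sequentially. a < (\<integral>y. H n y \<partial>P n)" 
      by (intro lower[of H h, OF Hm Hw hw Hh]) auto
  next
    fix a assume a: "(\<integral>y. h y \<partial>Q) < a"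
    have "\<forall>\<^sub>F n in sequentially. - a < (\<integral>y. - H n y \<partial>P n)"
    proof (rule lower[of "\<lambda>n y. - H n y" "\<lambda>y. - h y"])
      show "\<exists>\<delta>>0. \<exists>N. \<forall>n\<ge>N. \<forall>y'\<in>S. dist y y' < \<delta> \<longrightarrow> \<bar>- H n y' - - h y\<bar> < e" if "y \<in> S" "e > 0" for y e
        using Hh[OF that] by (simp add: abs_minus_commute)
    qed (use a Hw hw Hm in auto)
    then show "\<forall>\<^sub>F n in sequentially. (\<integral>y. H n y \<partial>P n) < a" by simp
  qed
qed

section \<open>The norm-weak topology\<close>

lemma rpow_nonneg: "0 \<le> rpow t q"
  by (simp add: rpow_def)

lemma continuous_on_rpow_norm: "q \<ge> 0 \<Longrightarrow> continuous_on S (\<lambda>t. rpow (norm t) q)"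
  unfolding rpow_def
  by (cases "q = 0") (simp, simp only: if_False, intro continuous_on_powr' continuous_intros, auto)

text \<open>Turns growth of order \<open>\<iota>\<close> of the cost into growth of order
  \<open>\<iota> * p\<close> of its \<open>p\<close>-th power, the order controlled by the norm-weak
  topology.\<close>

lemma rpow_growth_powr:
  assumes "a \<ge> 0" "t \<ge> 0" "\<iota> \<ge> 0" "p \<ge> 0" "\<bar>s\<bar> \<le> a * (rpow t \<iota> + 1)"
  shows "\<bar>s\<bar> powr p \<le> a powr p * 2 powr p * (rpow t (\<iota> * p) + 1)"
proof -
  have "\<bar>s\<bar> powr p \<le> (a * (rpow t \<iota> + 1)) powr p" using assms by (intro powr_mono2) auto
  also have "\<dots> = a powr p * (rpow t \<iota> + 1) powr p" by (simp add: powr_mult)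
  also have "\<dots> \<le> a powr p * (2 powr p * (rpow t \<iota> powr p + 1 powr p))"
    using assms by (intro mult_left_mono powr_add_le) (auto simp: rpow_nonneg)
  also have "\<dots> \<le> a powr p * (2 powr p * (rpow t (\<iota> * p) + 1))"
    by (intro mult_left_mono) (auto simp: rpow_def powr_powr)
  finally show ?thesis by (simp add: mult.assoc)
qed

text \<open>Every generating set consists of measures with finite moment, which gives the first
  claim. The second follows since preimages of open sets under integration of a test function are
  themselves generators.\<close>

lemma norm_weak_topology_continuous_map:
  assumes cont: "continuous_map T (norm_weak_topology q) K"
  shows "x \<in> topspace T \<Longrightarrow> K x \<in> moment_measures q"
    and "h \<in> norm_weak_test q \<Longrightarrow> continuous_map T euclideanreal (\<lambda>x. integral\<^sup>L (K x) h)"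
proof -
  have ts: "topspace (norm_weak_topology q) \<subseteq> moment_measures q"
    by (auto simp: norm_weak_topology_def)
  show *: "K x \<in> moment_measures q" if "x \<in> topspace T" for x
    using continuous_map_image_subset_topspace[OF cont] ts that by blast
  show "continuous_map T euclideanreal (\<lambda>x. integral\<^sup>L (K x) h)" if h: "h \<in> norm_weak_test q"
    unfolding continuous_map
  proof (intro conjI allI impI)
    fix V :: "real set" assume "openin euclideanreal V"
    then have "openin (norm_weak_topology q) {P \<in> moment_measures q. integral\<^sup>L P h \<in> V}"
      unfolding norm_weak_topology_def using h by (intro topology_generated_by_Basis) auto
    from openin_continuous_map_preimage[OF cont this]
    show "openin T {x \<in> topspace T. integral\<^sup>L (K x) h \<in> V}"
      using * by (simp cong: conj_cong)
  qed simp
qed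

lemma bounded_continuous_norm_weak_test:
  fixes \<phi> :: "'a::euclidean_space \<Rightarrow> real"
  assumes "continuous_on UNIV \<phi>" "bounded (range \<phi>)"
  shows "\<phi> \<in> norm_weak_test q"
proof -
  obtain B where B: "B > 0" "\<And>t. \<bar>\<phi> t\<bar> \<le> B" using assms(2) unfolding bounded_pos by auto
  have "B * 1 \<le> B * (rpow (norm t) q + 1)" for t :: 'a
    using B(1) rpow_nonneg[of "norm t" q] by (intro mult_left_mono) auto
  then have "\<bar>\<phi> t\<bar> \<le> B * (rpow (norm t) q + 1)" for t using B(2)[of t] by (metis mult.right_neutral order_trans)
  then show ?thesis using assms(1) B(1) by (auto simp: norm_weak_test_def)
qed

lemma rpow_norm_weak_test: "q \<ge> 0 \<Longrightarrow> (\<lambda>t::'a::euclidean_space. rpow (norm t) q) \<in> norm_weak_test q"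
  by (auto simp: norm_weak_test_def continuous_on_rpow_norm rpow_nonneg intro!: exI[of _ 1])

text \<open>The conditional laws live on the trace of the Borel sets on \<open>S\<close>, the
  topology on Borel measures of the whole space. Change of variables along the inclusion moves
  integrals between the two.\<close>

lemma extend_measure_borel_integral:
  fixes h :: "'a::euclidean_space \<Rightarrow> real"
  assumes "sets P = sets (restrict_space borel S)" "continuous_on UNIV h"
  shows "integral\<^sup>L (extend_measure_borel P) h = integral\<^sup>L P h"
    and "integrable (extend_measure_borel P) h \<longleftrightarrow> integrable P h"
proof -
  have "(\<lambda>y. y) \<in> P \<rightarrow>\<^sub>M borel"
    unfolding measurable_cong_sets[OF assms(1) refl] by (intro measurable_restrict_space1) simp
  moreover have "h \<in> borel_measurable borel" using assms(2) by (rule borel_measurable_continuous_onI)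
  ultimately show "integral\<^sup>L (extend_measure_borel P) h = integral\<^sup>L P h"
    and "integrable (extend_measure_borel P) h \<longleftrightarrow> integrable P h"
    by (simp_all add: extend_measure_borel_def integral_distr integrable_distr_eq)
qed

section \<open>Continuity of the conditional risk under a continuous policy\<close>

theorem proposition3p1:
  fixes \<X> :: "'x::euclidean_space set"
    and \<Y> :: "'y::euclidean_space set"
    and \<Z> :: "'z::euclidean_space set"
    and N :: "'v measure" and X :: "'v \<Rightarrow> 'x" and Y :: "'v \<Rightarrow> 'y"
    and P_YX :: "'x \<Rightarrow> 'y measure"
    and M :: "'w measure" and \<rho>2 :: "('w \<Rightarrow> real) \<Rightarrow> real"
    and g :: "'x \<Rightarrow> 'z" and c :: "'z \<Rightarrow> 'y \<Rightarrow> real" and \<eta> :: "'z \<Rightarrow> real"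
    and p \<iota> :: real
  assumes "\<X> \<noteq> {}" and "\<Y> \<noteq> {}" and "\<Z> \<noteq> {}"
    and "polish_subspace \<X>" and "polish_subspace \<Y>" and "polish_subspace \<Z>"
    and "closed \<Z>"
    and "prob_space N"
    and "X \<in> N \<rightarrow>\<^sub>M restrict_space borel \<X>" and "Y \<in> N \<rightarrow>\<^sub>M restrict_space borel \<Y>"
    and "conditional_distribution N (restrict_space borel \<X>) (restrict_space borel \<Y>) X Y P_YX"
    and "p \<ge> 1"
    and "prob_space M" and "nonatomic M"
    and "convex_risk_measure M p \<rho>2" and "law_invariant M p \<rho>2"
    and "g \<in> \<X> \<rightarrow> \<Z>" and "continuous_on \<X> g"
    and "continuous_on (\<Z> \<times> \<Y>) (\<lambda>(z, y). c z y)"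
    and "\<iota> \<ge> 0"
    and "\<forall>z\<in>\<Z>. \<eta> z \<ge> 0" and "locally_bounded_on \<Z> \<eta>"
    and "\<forall>z\<in>\<Z>. \<forall>y\<in>\<Y>. \<bar>c z y\<bar> \<le> \<eta> z * (rpow (norm y) \<iota> + 1)"
    and "continuous_map (top_of_set \<X>) (norm_weak_topology (\<iota> * p))
           (\<lambda>x. extend_measure_borel (P_YX x))"
  shows "continuous_on \<X> (\<lambda>x. risk_under M \<rho>2 (P_YX x) (c (g x)))"
proof -
  note p = \<open>p \<ge> 1\<close> and \<iota> = \<open>\<iota> \<ge> 0\<close>
  note c_cont = \<open>continuous_on (\<Z> \<times> \<Y>) (\<lambda>(z, y). c z y)\<close>
  note K_cont = \<open>continuous_map (top_of_set \<X>) (norm_weak_topology (\<iota> * p)) (\<lambda>x. extend_measure_borel (P_YX x))\<close>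
  have q: "\<iota> * p \<ge> 0" using p \<iota> by simp
  have K: "prob_space (P_YX x)" "sets (P_YX x) = sets (restrict_space borel \<Y>)" if "x \<in> \<X>" for x
  proof -
    have "P_YX \<in> restrict_space borel \<X> \<rightarrow>\<^sub>M prob_algebra (restrict_space borel \<Y>)"
      using assms by (simp add: conditional_distribution_def)
    then have "P_YX x \<in> space (prob_algebra (restrict_space borel \<Y>))"
      using that by (auto dest: measurable_space simp: space_restrict_space)
    then show "prob_space (P_YX x)" "sets (P_YX x) = sets (restrict_space borel \<Y>)"
      by (auto simp: space_prob_algebra)
  qed
  have gZ: "g x \<in> \<Z>" if "x \<in> \<X>" for x using assms that by blast
  have test: "continuous_on \<X> (\<lambda>x. integral\<^sup>L (P_YX x) h)" if h: "h \<in> norm_weak_test (\<iota> * p)" for h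
  proof -
    have "continuous_on UNIV h" using h by (simp add: norm_weak_test_def)
    then have "integral\<^sup>L (extend_measure_borel (P_YX x)) h = integral\<^sup>L (P_YX x) h" if "x \<in> \<X>" for x
      using K(2)[OF that] by (rule extend_measure_borel_integral(1)[rotated])
    with norm_weak_topology_continuous_map(2)[OF K_cont h] show ?thesis
      by (simp add: continuous_map_iff_continuous cong: continuous_on_cong)
  qed
  have moment: "integrable (P_YX x) (\<lambda>y. rpow (norm y) (\<iota> * p))" if "x \<in> \<X>" for x
    using norm_weak_topology_continuous_map(1)[OF K_cont, of x] that
      extend_measure_borel_integral(2)[OF K(2)[OF that] continuous_on_rpow_norm[OF q]]
    by (simp add: moment_measures_def)
  have c_meas: "c z \<in> borel_measurable (restrict_space borel \<Y>)" if "z \<in> \<Z>" for z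
  proof -
    have "continuous_on \<Y> (\<lambda>y. (\<lambda>(z, y). c z y) (z, y))"
      using that by (intro continuous_on_compose2[OF c_cont] continuous_intros) auto
    then show ?thesis by (intro borel_measurable_continuous_on_restrict) simp
  qed
  show ?thesis
    unfolding continuous_on_sequentially
  proof (intro ballI allI impI, elim conjE, unfold comp_def)
    fix xs x assume x: "x \<in> \<X>" and "\<forall>n. xs n \<in> \<X>" and xs_lim: "xs \<longlonglongrightarrow> x"
    then have xs: "xs n \<in> \<X>" for n by simp
    have gxs: "(\<lambda>n. g (xs n)) \<longlonglongrightarrow> g x"
      using \<open>continuous_on \<X> g\<close> x xs xs_lim by (simp add: continuous_on_tendsto_compose)
    \<comment> \<open>Local boundedness of \<open>\<eta>\<close> at \<open>g x\<close> yields one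
      growth constant for all policy values in a neighbourhood \<open>V\<close>.\<close>
    obtain V where V: "open V" "g x \<in> V" "bounded (\<eta> ` (V \<inter> \<Z>))"
      using \<open>locally_bounded_on \<Z> \<eta>\<close> gZ[OF x] unfolding locally_bounded_on_def by blast
    then obtain B where B: "B > 0" "\<And>z. z \<in> V \<inter> \<Z> \<Longrightarrow> \<bar>\<eta> z\<bar> \<le> B"
      unfolding bounded_pos by auto
    obtain n0 where n0: "\<And>n. n \<ge> n0 \<Longrightarrow> g (xs n) \<in> V"
      using topological_tendstoD[OF gxs V(1,2)] unfolding eventually_sequentially by blast
    \<comment> \<open>Dropping the first \<open>n0\<close> terms makes the growth bound hold for
      every index, not just eventually; the shift is undone at the end.\<close>
    define x' where "x' n = xs (n + n0)" for n
    have x'X: "x' n \<in> \<X>" for n using xs by (simp add: x'_def)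
    have x'lim: "x' \<longlonglongrightarrow> x" unfolding x'_def using xs_lim by (rule LIMSEQ_ignore_initial_segment)
    have gx': "(\<lambda>n. g (x' n)) \<longlonglongrightarrow> g x"
      unfolding x'_def using gxs by (rule LIMSEQ_ignore_initial_segment)
    define D where "D = B powr p * 2 powr p"
    have D: "D \<ge> 0" by (simp add: D_def)
    have growth: "\<bar>c z y\<bar> powr p \<le> D * (rpow (norm y) (\<iota> * p) + 1)"
      if "z \<in> V \<inter> \<Z>" "y \<in> \<Y>" for z y
      unfolding D_def
    proof (rule rpow_growth_powr)
      have "\<bar>c z y\<bar> \<le> \<eta> z * (rpow (norm y) \<iota> + 1)" using assms that by blast
      also have "\<dots> \<le> B * (rpow (norm y) \<iota> + 1)"
        using B(2)[OF that(1)] rpow_nonneg[of "norm y" \<iota>] by (intro mult_right_mono) auto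
      finally show "\<bar>c z y\<bar> \<le> B * (rpow (norm y) \<iota> + 1)" .
    qed (use B p \<iota> in auto)
    have zs: "g (x' n) \<in> V \<inter> \<Z>" "g x \<in> V \<inter> \<Z>" for n
      using n0 gZ x x'X V by (auto simp: x'_def)
    \<comment> \<open>The leading 1 matches the bound \<open>1 + \<bar>s\<bar> powr p\<close> on
      test functions, the rest is the growth bound for the cost. The integral of \<open>w\<close> is
      affine in the moment of order \<open>\<iota> * p\<close>, whose integrand is itself a
      norm-weak test function, so it converges.\<close>
    define w where "w y = 1 + D * (rpow (norm y) (\<iota> * p) + 1)" for y :: 'y
    have w_cont: "continuous_on A w" for A
      unfolding w_def using q by (intro continuous_intros continuous_on_rpow_norm)
    have w_int: "integrable (P_YX u) w" and w_val: "(\<integral>y. w y \<partial>P_YX u) = 1 + D * ((\<integral>y. rpow (norm y) (\<iota> * p) \<partial>P_YX u) + 1)" if u: "u \<in> \<X>" for u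
    proof -
      interpret prob_space "P_YX u" by (rule K(1)[OF u])
      show "integrable (P_YX u) w" unfolding w_def using moment[OF u] by simp
      show "(\<integral>y. w y \<partial>P_YX u) = 1 + D * ((\<integral>y. rpow (norm y) (\<iota> * p) \<partial>P_YX u) + 1)"
        unfolding w_def using moment[OF u] by (simp add: prob_space)
    qed
    have seq: "(\<lambda>n. integral\<^sup>L (P_YX (x' n)) h) \<longlonglongrightarrow> integral\<^sup>L (P_YX x) h" if "h \<in> norm_weak_test (\<iota> * p)" for h
      using continuous_on_tendsto_compose[OF test[OF that] x'lim x] x'X by simp
    have w_lim: "(\<lambda>n. \<integral>y. w y \<partial>P_YX (x' n)) \<longlonglongrightarrow> (\<integral>y. w y \<partial>P_YX x)"
      unfolding w_val[OF x] w_val[OF x'X] by (intro tendsto_intros seq rpow_norm_weak_test q)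
    have c_int: "integrable (P_YX u) (\<lambda>y. \<bar>c (g u) y\<bar> powr p)" if u: "u \<in> \<X>" "g u \<in> V" for u
    proof (rule Bochner_Integration.integrable_bound[OF w_int[OF u(1)]])
      have [measurable]: "c (g u) \<in> borel_measurable (P_YX u)"
        unfolding measurable_cong_sets[OF K(2)[OF u(1)] refl] by (rule c_meas[OF gZ[OF u(1)]])
      show "(\<lambda>y. \<bar>c (g u) y\<bar> powr p) \<in> borel_measurable (P_YX u)" by measurable
      have "space (P_YX u) = \<Y>"
        using sets_eq_imp_space_eq[OF K(2)[OF u(1)]] by (simp add: space_restrict_space)
      then show "AE y in P_YX u. norm (\<bar>c (g u) y\<bar> powr p) \<le> norm (w y)"
        using growth[of "g u"] gZ u by (intro AE_I2) (force simp: w_def)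
    qed
    have "(\<lambda>n. risk_under M \<rho>2 (P_YX (x' n)) (c (g (x' n)))) \<longlonglongrightarrow> risk_under M \<rho>2 (P_YX x) (c (g x))"
    proof (rule risk_under_tendsto[OF \<open>prob_space M\<close> \<open>nonatomic M\<close> \<open>convex_risk_measure M p \<rho>2\<close> p K(1)[OF x'X] K(1)[OF x]])
      show "c (g (x' n)) \<in> borel_measurable (P_YX (x' n))" for n
        unfolding measurable_cong_sets[OF K(2)[OF x'X] refl] by (rule c_meas[OF gZ[OF x'X]])
      show "c (g x) \<in> borel_measurable (P_YX x)"
        unfolding measurable_cong_sets[OF K(2)[OF x] refl] by (rule c_meas[OF gZ[OF x]])
      show "integrable (P_YX (x' n)) (\<lambda>y. \<bar>c (g (x' n)) y\<bar> powr p)" for n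
        using zs x'X by (intro c_int) auto
      show "integrable (P_YX x) (\<lambda>y. \<bar>c (g x) y\<bar> powr p)"
        using zs x by (intro c_int) auto
      fix f :: "real \<Rightarrow> real" assume f: "continuous_on UNIV f" and f_le: "\<And>s. \<bar>f s\<bar> \<le> 1 + \<bar>s\<bar> powr p"
      have fm: "f \<in> borel_measurable borel" using f by (rule borel_measurable_continuous_onI)
      show "(\<lambda>n. \<integral>y. f (c (g (x' n)) y) \<partial>P_YX (x' n)) \<longlonglongrightarrow> (\<integral>y. f (c (g x) y) \<partial>P_YX x)"
      proof (rule integral_tendsto_varying_measure[OF K[OF x'X] K[OF x] _ w_cont w_int[OF x'X] w_int[OF x] w_lim])
        show "(\<lambda>n. integral\<^sup>L (P_YX (x' n)) \<phi>) \<longlonglongrightarrow> integral\<^sup>L (P_YX x) \<phi>"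
          if "continuous_on UNIV \<phi>" "bounded (range \<phi>)" for \<phi> :: "'y \<Rightarrow> real"
          using bounded_continuous_norm_weak_test[OF that] by (rule seq)
        show "(\<lambda>y. f (c (g (x' n)) y)) \<in> borel_measurable (restrict_space borel \<Y>)" for n
          by (rule measurable_compose[OF c_meas[OF gZ[OF x'X]] fm])
        show "(\<lambda>y. f (c (g x) y)) \<in> borel_measurable (restrict_space borel \<Y>)"
          by (rule measurable_compose[OF c_meas[OF gZ[OF x]] fm])
        show "\<bar>f (c (g (x' n)) y)\<bar> \<le> w y" if "y \<in> \<Y>" for n y
          using f_le[of "c (g (x' n)) y"] growth[OF zs(1) that, of n] by (simp add: w_def)
        fix y and e :: real assume y: "y \<in> \<Y>" and e: "e > 0"
        \<comment> \<open>Joint continuity of the composite at \<open>(g x, y)\<close> gives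
          continuous convergence: half of the radius \<open>d\<close> is spent on the policy value
          \<open>g (x' n)\<close>, the other half on \<open>y'\<close>.\<close>
        have "continuous_on (\<Z> \<times> \<Y>) (\<lambda>v. f (case v of (z, y) \<Rightarrow> c z y))"
          by (rule continuous_on_compose2[OF f c_cont]) simp
        then obtain d where d: "d > 0" "\<And>v. v \<in> \<Z> \<times> \<Y> \<Longrightarrow> dist v (g x, y) < d \<Longrightarrow>
            dist (f (case v of (z, y) \<Rightarrow> c z y)) (f (case (g x, y) of (z, y) \<Rightarrow> c z y)) < e"
          using gZ[OF x] y e unfolding continuous_on_iff by (metis SigmaI)
        obtain n1 where n1: "\<And>n. n \<ge> n1 \<Longrightarrow> dist (g (x' n)) (g x) < d / 2"
          using gx' d(1) unfolding lim_sequentially by (metis half_gt_zero)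
        show "\<exists>\<delta>>0. \<exists>N. \<forall>n\<ge>N. \<forall>y'\<in>\<Y>. dist y y' < \<delta> \<longrightarrow> \<bar>f (c (g (x' n)) y') - f (c (g x) y)\<bar> < e"
        proof (intro exI[of _ "d / 2"] conjI exI[of _ n1] allI ballI impI)
          fix n y' assume *: "n1 \<le> n" "y' \<in> \<Y>" "dist y y' < d / 2"
          have "dist (g (x' n), y') (g x, y) \<le> dist (g (x' n)) (g x) + dist y' y"
            unfolding dist_Pair_Pair by (rule sqrt_sum_squares_le_sum) auto
          also have "\<dots> < d" using n1[OF *(1)] *(3) by (simp add: dist_commute)
          finally show "\<bar>f (c (g (x' n)) y') - f (c (g x) y)\<bar> < e"
            using d(2)[of "(g (x' n), y')"] gZ[OF x'X] *(2) by (simp add: dist_real_def)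
        qed (use d in simp)
      qed
    qed
    then show "(\<lambda>n. risk_under M \<rho>2 (P_YX (xs n)) (c (g (xs n)))) \<longlonglongrightarrow> risk_under M \<rho>2 (P_YX x) (c (g x))"
      unfolding x'_def by (rule LIMSEQ_offset)
  qed
qed

end
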